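(* Let $n$ be a positive integer, $0<p\leq q<\infty$, let $\mathbf{u}=(u_0,u_1,\dots,u_n)$ with each $u_k\in H(\mathbb{D})$, and let $\mu$ be a positive Borel measure on $\mathbb{D}$. Then: (a) $\mu$ is a $(\mathbf{u},p,q)$-Sobolev Carleson measure if and only if, for each $0\leq k\leq n$, the measure $|u_k|^q\,d\mu$ is a $(k,p,q)$-Carleson measure; (b) $\mu$ is a vanishing $(\mathbf{u},p,q)$-Sobolev Carleson measure if and only if, for each $0\leq k\leq n$, the measure $|u_k|^q\,d\mu$ is a vanishing $(k,p,q)$-Carleson measure.
   Context: $\mathbb{D}$ is the open unit disc, $H(\mathbb{D})$ the space of analytic functions on $\mathbb{D}$, $dA=\frac{dx\,dy}{\pi}$ normalized area measure. For $0<p<\infty$, the Bergman space $A^p$ consists of $f\in H(\mathbb{D})$ with $\|f\|_p^p=\int_{\mathbb{D}}|f|^p\,dA<\infty$. For an integer $k\geq0$, a positive Borel measure $\nu$ on $\mathbb{D}$ is a $(k,p,q)$-Carleson measure if there is $C>0$ with $\int_{\mathbb{D}}|f^{(k)}|^q\,d\nu\leq C\|f\|_p^q$ for all $f\in A^p$; it is a vanishing $(k,p,q)$-Carleson measure if $\int_{\mathbb{D}}|f_j^{(k)}|^q\,d\nu\to0$ whenever $\{f_j\}$ is a bounded sequence in $A^p$ converging to $0$ uniformly on compact subsets of $\mathbb{D}$. Writing $\langle\mathbf{u},\mathcal{D}f\rangle=u_0f+u_1f'+\cdots+u_nf^{(n)}$, $\mu$ is a $(\mathbf{u},p,q)$-Sobolev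 Carleson measure if there is $C>0$ with $\int_{\mathbb{D}}|\langle\mathbf{u}(z),\mathcal{D}f(z)\rangle|^q\,d\mu(z)\leq C\|f\|_p^q$ for all $f\in A^p$, and a vanishing $(\mathbf{u},p,q)$-Sobolev Carleson measure if $\int_{\mathbb{D}}|\langle\mathbf{u},\mathcal{D}f_j\rangle|^q\,d\mu\to0$ whenever $\{f_j\}$ is bounded in $A^p$ and converges to $0$ uniformly on compact subsets of $\mathbb{D}$. *)

theory Defs
  imports "HOL-Complex_Analysis.Complex_Analysis"
begin

definition disc :: "complex set" where
  "disc = ball 0 1"

text \<open>The p-th power of the Bergman norm w.r.t. normalized area measure dA = dx dy / pi.\<close>
definition bergman_pnorm_pow :: "real \<Rightarrow> (complex \<Rightarrow> complex) \<Rightarrow> ennreal" where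
  "bergman_pnorm_pow p f =
     (\<integral>\<^sup>+ z. indicator disc z * ennreal (norm (f z) powr p) \<partial>lborel) / ennreal pi"

definition bergman_space :: "real \<Rightarrow> (complex \<Rightarrow> complex) set" where
  "bergman_space p = {f. f holomorphic_on disc \<and> bergman_pnorm_pow p f < \<infinity>}"

definition bergman_norm :: "real \<Rightarrow> (complex \<Rightarrow> complex) \<Rightarrow> real" where
  "bergman_norm p f = enn2real (bergman_pnorm_pow p f) powr (1 / p)"

definition borel_measure_on_disc :: "complex measure \<Rightarrow> bool" where
  "borel_measure_on_disc \<nu> \<longleftrightarrow> sets \<nu> = sets (restrict_space borel disc)"

abbreviation kderiv :: "nat \<Rightarrow> (complex \<Rightarrow> complex) \<Rightarrow> complex \<Rightarrow> complex" where
  "kderiv k f \<equiv> (deriv ^^ k) f"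

definition bergman_null_seq :: "real \<Rightarrow> (nat \<Rightarrow> complex \<Rightarrow> complex) \<Rightarrow> bool" where
  "bergman_null_seq p F \<longleftrightarrow>
     (\<forall>j. F j \<in> bergman_space p) \<and>
     (\<exists>M. \<forall>j. bergman_norm p (F j) \<le> M) \<and>
     (\<forall>K. compact K \<and> K \<subseteq> disc \<longrightarrow> uniform_limit K F (\<lambda>_. 0) sequentially)"

definition carleson :: "nat \<Rightarrow> real \<Rightarrow> real \<Rightarrow> complex measure \<Rightarrow> bool" where
  "carleson k p q \<nu> \<longleftrightarrow>
     (\<exists>C>0. \<forall>f \<in> bergman_space p.
        (\<integral>\<^sup>+ z. ennreal (norm (kderiv k f z) powr q) \<partial>\<nu>) \<le> ennreal (C * bergman_norm p f powr q))"

definition vanishing_carleson :: "nat \<Rightarrow> real \<Rightarrow> real \<Rightarrow> complex measure \<Rightarrow> bool" where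
  "vanishing_carleson k p q \<nu> \<longleftrightarrow>
     (\<forall>F. bergman_null_seq p F \<longrightarrow>
        (\<lambda>j. \<integral>\<^sup>+ z. ennreal (norm (kderiv k (F j) z) powr q) \<partial>\<nu>) \<longlonglongrightarrow> 0)"

definition sobolev_op :: "nat \<Rightarrow> (nat \<Rightarrow> complex \<Rightarrow> complex) \<Rightarrow> (complex \<Rightarrow> complex) \<Rightarrow> complex \<Rightarrow> complex" where
  "sobolev_op n u f z = (\<Sum>k\<le>n. u k z * kderiv k f z)"

definition sobolev_carleson :: "nat \<Rightarrow> (nat \<Rightarrow> complex \<Rightarrow> complex) \<Rightarrow> real \<Rightarrow> real \<Rightarrow> complex measure \<Rightarrow> bool" where
  "sobolev_carleson n u p q \<mu> \<longleftrightarrow>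
     (\<exists>C>0. \<forall>f \<in> bergman_space p.
        (\<integral>\<^sup>+ z. ennreal (norm (sobolev_op n u f z) powr q) \<partial>\<mu>) \<le> ennreal (C * bergman_norm p f powr q))"

definition vanishing_sobolev_carleson :: "nat \<Rightarrow> (nat \<Rightarrow> complex \<Rightarrow> complex) \<Rightarrow> real \<Rightarrow> real \<Rightarrow> complex measure \<Rightarrow> bool" where
  "vanishing_sobolev_carleson n u p q \<mu> \<longleftrightarrow>
     (\<forall>F. bergman_null_seq p F \<longrightarrow>
        (\<lambda>j. \<integral>\<^sup>+ z. ennreal (norm (sobolev_op n u (F j) z) powr q) \<partial>\<mu>) \<longlonglongrightarrow> 0)"

definition weighted_measure :: "complex measure \<Rightarrow> (complex \<Rightarrow> complex) \<Rightarrow> real \<Rightarrow> complex measure" where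
  "weighted_measure \<mu> g q = density \<mu> (\<lambda>z. ennreal (norm (g z) powr q))"

end

theory Submission
  imports Defs
begin

text \<open>
  For \<open>a\<close> in the disc put \<open>d = 1 - norm a\<close> and consider the functions
  \<open>((w - a) / d) ^ i * (d / (1 - cnj a * w)) ^ N\<close> for \<open>i \<le> n\<close>; for large \<open>N\<close> the \<open>p\<close>-th power of
  their norm is at most a constant times \<open>d\<^sup>2\<close>. For fixed \<open>z\<close> the binomial theorem combines them into
  \<open>((w - z) / d) ^ k * (d / (1 - cnj a * w)) ^ N\<close>, whose derivatives at \<open>z\<close> of order below \<open>k\<close> vanish.
  Hence the values of the Sobolev operator on these functions form a triangular system for the
  coefficients, and downward induction on \<open>k\<close> bounds \<open>norm (u k z)\<close> near \<open>a\<close> by \<open>d ^ k\<close> times these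
  values. A Sobolev Carleson measure therefore has \<open>(norm (u k)) powr q\<close>-weighted mass at most a
  constant times \<open>d powr ((k + 2 / p) * q)\<close> near \<open>a\<close>, with a factor tending to \<open>0\<close> at the boundary in the
  vanishing case. Conversely, the sub-mean value property of \<open>(norm f) powr p\<close> together with Cauchy's
  inequality and Tonelli's theorem turns such local bounds into (vanishing) Carleson conditions.
\<close>

section \<open>Area mean values\<close>

text \<open>A single value \<open>sobolev_op n u f z\<close> may be small through cancellation while
  its terms are large, so several functions are needed to separate the \<open>u k z\<close>. A
  function adapted to \<open>z\<close> cannot serve directly, because the hypothesis integrates over
  \<open>z\<close> with the function held fixed. Hence only finitely many functions centred at
  \<open>a\<close> are integrated; their recombination, whose coefficients depend on
  \<open>z\<close> but stay bounded near \<open>a\<close>, happens pointwise. The local exponent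
  \<open>(k + 2 / p) * q\<close> collects \<open>d ^ k\<close> from the coefficient bound and
  \<open>d powr (2 / p)\<close> from the norms of the test functions, both raised to the power
  \<open>q\<close>. Two obstacles shape the rest. For \<open>p < 1\<close> neither Hoelder nor
  Jensen is available, so the sub-mean value property is derived by hand from the area mean value
  inequality. And nothing makes \<open>\<mu>\<close> sigma-finite, while Tonelli's theorem asks for
  it: finiteness of each weighted measure is extracted from the hypothesis by taking
  \<open>a = 0\<close>, whose region is the whole disc.\<close>

lemma lborel_complex_eq: "distr (lborel \<Otimes>\<^sub>M lborel) borel (\<lambda>(x, y). Complex x y) = lborel"
proof (rule lborel_eqI[symmetric])
  have m[measurable]: "(\<lambda>(x, y). Complex x y) \<in> borel_measurable (lborel \<Otimes>\<^sub>M lborel)"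
    unfolding split_beta' Complex_eq by measurable
  fix l u :: complex
  assume le: "\<And>b. b \<in> Basis \<Longrightarrow> l \<bullet> b \<le> u \<bullet> b"
  then have le': "Re l \<le> Re u" "Im l \<le> Im u"
    using le[of 1] le[of \<i>] by (simp_all add: Basis_complex_def)
  have vim: "(\<lambda>(x, y). Complex x y) -` box l u \<inter> space (lborel \<Otimes>\<^sub>M lborel) = {Re l<..<Re u} \<times> {Im l<..<Im u}"
    by (auto simp: box_def Basis_complex_def space_pair_measure)
  have "emeasure (distr (lborel \<Otimes>\<^sub>M lborel) borel (\<lambda>(x, y). Complex x y)) (box l u) =
      emeasure lborel {Re l<..<Re u} * emeasure lborel {Im l<..<Im u}"
    by (subst emeasure_distr) (simp_all add: m vim lborel.emeasure_pair_measure_Times)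
  also have "\<dots> = (\<Prod>b\<in>Basis. (u - l) \<bullet> b)"
    using le' by (simp add: Basis_complex_def ennreal_mult'')
  finally show "emeasure (distr (lborel \<Otimes>\<^sub>M lborel) borel (\<lambda>(x, y). Complex x y)) (box l u) =
     (\<Prod>b\<in>Basis. (u - l) \<bullet> b)" .
qed simp

lemma measurable_Complex[measurable]:
  "(\<lambda>(x, y). Complex x y) \<in> borel_measurable (borel \<Otimes>\<^sub>M borel)"
  "f \<in> borel_measurable M \<Longrightarrow> g \<in> borel_measurable M \<Longrightarrow> (\<lambda>x. Complex (f x) (g x)) \<in> borel_measurable M"
  unfolding split_beta' Complex_eq by (simp_all, measurable)

lemma nn_integral_lborel_complex:
  assumes [measurable]: "h \<in> borel_measurable borel"
  shows "(\<integral>\<^sup>+z. h z \<partial>lborel) = (\<integral>\<^sup>+x. \<integral>\<^sup>+y. h (Complex x y) \<partial>lborel \<partial>lborel)"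
    and "(\<integral>\<^sup>+z. h z \<partial>lborel) = (\<integral>\<^sup>+y. \<integral>\<^sup>+x. h (Complex x y) \<partial>lborel \<partial>lborel)"
proof -
  have "(\<integral>\<^sup>+z. h z \<partial>lborel) = (\<integral>\<^sup>+z. h (case z of (x, y) \<Rightarrow> Complex x y) \<partial>(lborel \<Otimes>\<^sub>M lborel))"
    by (subst lborel_complex_eq[symmetric], subst nn_integral_distr) auto
  also have "\<dots> = (\<integral>\<^sup>+x. \<integral>\<^sup>+y. h (Complex x y) \<partial>lborel \<partial>lborel)"
    by (subst lborel.nn_integral_fst[symmetric]) auto
  finally show *: "(\<integral>\<^sup>+z. h z \<partial>lborel) = (\<integral>\<^sup>+x. \<integral>\<^sup>+y. h (Complex x y) \<partial>lborel \<partial>lborel)" .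
  also have "\<dots> = (\<integral>\<^sup>+y. \<integral>\<^sup>+x. h (Complex x y) \<partial>lborel \<partial>lborel)"
    by (rule lborel_pair.Fubini'[symmetric]) measurable
  finally show "(\<integral>\<^sup>+z. h z \<partial>lborel) = (\<integral>\<^sup>+y. \<integral>\<^sup>+x. h (Complex x y) \<partial>lborel \<partial>lborel)" .
qed

text \<open>With the imaginary part as outer variable, the shear is a translation of the inner
  one.\<close>

lemma nn_integral_shear_Re:
  assumes [measurable]: "h \<in> borel_measurable borel"
  shows "(\<integral>\<^sup>+z. h (Complex (Re z + t * Im z) (Im z)) \<partial>lborel) = (\<integral>\<^sup>+z. h z \<partial>lborel)"
proof -
  have "(\<integral>\<^sup>+x. h (Complex x y) \<partial>lborel) = (\<integral>\<^sup>+x. h (Complex (t * y + 1 * x) y) \<partial>lborel)" for y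
    by (subst nn_integral_real_affine[where c = 1 and t = "t * y"]) auto
  then show ?thesis
    by (simp add: nn_integral_lborel_complex(2) add.commute)
qed

lemma nn_integral_shear_Im:
  assumes [measurable]: "h \<in> borel_measurable borel"
  shows "(\<integral>\<^sup>+z. h (Complex (Re z) (Im z + t * Re z)) \<partial>lborel) = (\<integral>\<^sup>+z. h z \<partial>lborel)"
proof -
  have "(\<integral>\<^sup>+y. h (Complex x y) \<partial>lborel) = (\<integral>\<^sup>+y. h (Complex x (t * x + 1 * y)) \<partial>lborel)" for x
    by (subst nn_integral_real_affine[where c = 1 and t = "t * x"]) auto
  then show ?thesis
    by (simp add: nn_integral_lborel_complex(1) add.commute)
qed

text \<open>A rotation by an angle other than \<open>\<pi>\<close> is a product of three shears.\<close>

lemma nn_integral_rotate: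
  fixes c :: complex
  assumes h[measurable]: "h \<in> borel_measurable borel" and c: "norm c = 1"
  shows "(\<integral>\<^sup>+z. h (c * z) \<partial>lborel) = (\<integral>\<^sup>+z. h z \<partial>lborel)"
proof -
  have *: "(\<integral>\<^sup>+z. h (c * z) \<partial>lborel) = (\<integral>\<^sup>+z. h z \<partial>lborel)"
    if c: "norm c = 1" "c \<noteq> -1" and h[measurable]: "h \<in> borel_measurable borel" for c :: complex and h
  proof -
    define a b where "a = Re c" and "b = Im c"
    have ab: "a\<^sup>2 + b\<^sup>2 = 1"
      using c by (simp add: a_def b_def cmod_def)
    have a: "1 + a \<noteq> 0"
    proof
      assume "1 + a = 0"
      then have "a = -1" by simp
      with ab have "b = 0" by simp
      with \<open>a = -1\<close> c show False by (simp add: a_def b_def complex_eq_iff)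
    qed
    \<comment> \<open>\<open>\<tau>\<close> is the tangent of half the rotation angle, finite
      because \<open>c\<close> is not \<open>-1\<close>. A horizontal shear by
      \<open>-\<tau>\<close>, a vertical one by \<open>b\<close> and the horizontal one again
      compose to multiplication by \<open>c\<close>.\<close>
    define \<tau> where "\<tau> = b / (1 + a)"
    have tb: "1 - \<tau> * b = a"
      using a ab by (simp add: \<tau>_def field_simps power2_eq_square)
    have t2: "\<tau> * (1 + a) = b"
      using a by (simp add: \<tau>_def)
    have cz: "c * z = Complex (Re z - \<tau> * Im z - \<tau> * (Im z + b * (Re z - \<tau> * Im z))) (Im z + b * (Re z - \<tau> * Im z))" for z
    proof -
      have "Im z + b * (Re z - \<tau> * Im z) = (1 - \<tau> * b) * Im z + b * Re z"
        by (simp add: algebra_simps)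
      then have 1: "Im z + b * (Re z - \<tau> * Im z) = a * Im z + b * Re z"
        by (simp add: tb)
      have "Re z - \<tau> * Im z - \<tau> * (a * Im z + b * Re z) = (1 - \<tau> * b) * Re z - \<tau> * (1 + a) * Im z"
        by (simp add: algebra_simps)
      then have 2: "Re z - \<tau> * Im z - \<tau> * (a * Im z + b * Re z) = a * Re z - b * Im z"
        by (simp add: tb t2)
      show ?thesis
        unfolding 1 2 by (simp add: complex_eq_iff a_def b_def)
    qed
    define h1 where "h1 z = h (Complex (Re z + (-\<tau>) * Im z) (Im z))" for z
    define h2 where "h2 z = h1 (Complex (Re z) (Im z + b * Re z))" for z
    have [measurable]: "h1 \<in> borel_measurable borel" "h2 \<in> borel_measurable borel"
      unfolding h1_def h2_def by measurable
    have "(\<integral>\<^sup>+z. h (c * z) \<partial>lborel) = (\<integral>\<^sup>+z. h2 (Complex (Re z + (-\<tau>) * Im z) (Im z)) \<partial>lborel)"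
      by (simp add: cz h1_def h2_def)
    also have "\<dots> = (\<integral>\<^sup>+z. h2 z \<partial>lborel)"
      by (rule nn_integral_shear_Re) measurable
    also have "\<dots> = (\<integral>\<^sup>+z. h1 z \<partial>lborel)"
      unfolding h2_def by (rule nn_integral_shear_Im) measurable
    also have "\<dots> = (\<integral>\<^sup>+z. h z \<partial>lborel)"
      unfolding h1_def by (rule nn_integral_shear_Re) measurable
    finally show ?thesis .
  qed
  show ?thesis
  proof (cases "c = -1")
    \<comment> \<open>The half turn is made of two quarter turns, each covered by the first
      case.\<close>
    case True
    have "(\<integral>\<^sup>+z. h (\<i> * (\<i> * z)) \<partial>lborel) = (\<integral>\<^sup>+z. h (\<i> * z) \<partial>lborel)"
      by (rule *[where h = "\<lambda>z. h (\<i> * z)"]) (auto simp: complex_eq_iff)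
    also have "\<dots> = (\<integral>\<^sup>+z. h z \<partial>lborel)"
      by (rule *) (auto simp: complex_eq_iff)
    finally show ?thesis
      using True by simp
  qed (use * c h in auto)
qed

section \<open>Mean value inequalities on circles and discs\<close>

lemma mean_value_circle:
  assumes "f holomorphic_on S" "open S" "cball z r \<subseteq> S" "r > 0"
  shows "((\<lambda>t. f (z + r * cis (2 * pi * t))) has_integral f z) {0..1}"
proof -
  have "((\<lambda>u. f u / (u - z)) has_contour_integral (2 * of_real pi * \<i> * f z)) (circlepath z r)"
    using assms by (intro Cauchy_integral_circlepath_simple) (auto intro: holomorphic_on_subset)
  then have "((\<lambda>t. f (circlepath z r t) / (circlepath z r t - z) * vector_derivative (circlepath z r) (at t))
      has_integral (2 * of_real pi * \<i> * f z)) {0..1}"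
    by (simp add: has_contour_integral)
  also have "(\<lambda>t. f (circlepath z r t) / (circlepath z r t - z) * vector_derivative (circlepath z r) (at t)) =
     (\<lambda>t. 2 * of_real pi * \<i> * f (z + r * cis (2 * pi * t)))"
    using assms by (auto simp: vector_derivative_circlepath, auto simp: circlepath cis_conv_exp mult_ac)
  finally have "((\<lambda>t. inverse (2 * of_real pi * \<i>) * (2 * of_real pi * \<i> * f (z + r * cis (2 * pi * t))))
      has_integral inverse (2 * of_real pi * \<i>) * (2 * of_real pi * \<i> * f z)) {0..1}"
    by (rule has_integral_mult_right)
  moreover have "inverse (2 * of_real pi * \<i>) * (2 * of_real pi * \<i> * x) = x" for x :: complex
    by (subst mult.assoc[symmetric], subst left_inverse) auto
  ultimately show ?thesis
    by (simp only:)
qed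

text \<open>The circle is swept out by rotating a vector \<open>\<zeta>\<close> rather than
  described by a radius and an angle; in this form the inequality can afterwards be integrated over
  \<open>\<zeta>\<close> in the plane.\<close>

lemma mean_value_circle_le:
  assumes "f holomorphic_on S" "open S" "cball z (norm \<zeta>) \<subseteq> S"
  shows "ennreal (norm (f z)) \<le> (\<integral>\<^sup>+t. ennreal (norm (f (z + cis (2 * pi * t) * \<zeta>))) * indicator {0..1} t \<partial>lborel)"
proof -
  have mem: "z + cis (2 * pi * t) * \<zeta> \<in> S" for t
    using assms(3) by (auto simp: subset_iff dist_norm norm_mult)
  have cont: "continuous_on {0..1} (\<lambda>t::real. f (z + cis (2 * pi * t) * \<zeta>))"
  proof (rule continuous_on_compose2[OF holomorphic_on_imp_continuous_on[OF assms(1)]])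
    show "continuous_on {0..1} (\<lambda>t::real. z + cis (2 * pi * t) * \<zeta>)"
      unfolding cis_conv_exp by (intro continuous_intros)
  qed (use mem in auto)
  have int: "((\<lambda>t. f (z + cis (2 * pi * t) * \<zeta>)) has_integral f z) {0..1}"
  proof (cases "\<zeta> = 0")
    case True
    then show ?thesis
      using has_integral_const_real[of "f z" 0 1] by simp
  next
    case False
    \<comment> \<open>Turning the coordinate by the argument of \<open>\<zeta>\<close> makes the
      circle start at \<open>norm \<zeta>\<close>, as in the previous lemma.\<close>
    define \<omega> where "\<omega> = Arg \<zeta>"
    define g where "g w = f (z + cis \<omega> * w)" for w
    have "((\<lambda>t. g (0 + norm \<zeta> * cis (2 * pi * t))) has_integral g 0) {0..1}"
    proof (rule mean_value_circle)
      have "continuous_on UNIV (\<lambda>w. z + cis \<omega> * w)"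
        by (intro continuous_intros)
      then show "open ((\<lambda>w. z + cis \<omega> * w) -` S)"
        using assms(2) by (auto intro: open_vimage)
      show "cball 0 (cmod \<zeta>) \<subseteq> (\<lambda>w. z + cis \<omega> * w) -` S"
        using assms(3) by (auto simp: subset_iff dist_norm norm_mult)
      show "g holomorphic_on ((\<lambda>w. z + cis \<omega> * w) -` S)"
        unfolding g_def
        by (intro holomorphic_on_compose_gen[OF _ assms(1), unfolded o_def] holomorphic_intros) auto
    qed (use False in auto)
    moreover have "cis \<omega> * (norm \<zeta> * w) = w * \<zeta>" for w :: complex
      using rcis_cmod_Arg[of \<zeta>] by (simp add: \<omega>_def rcis_def algebra_simps)
    ultimately show ?thesis
      unfolding g_def by (simp only: add_0_left mult_zero_right add_0_right)
  qed
  have "norm (f z) = norm (integral {0..1} (\<lambda>t. f (z + cis (2 * pi * t) * \<zeta>)))"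
    using int by (simp add: integral_unique)
  also have "\<dots> \<le> integral {0..1} (\<lambda>t. norm (f (z + cis (2 * pi * t) * \<zeta>)))"
    using cont by (intro integral_norm_bound_integral integrable_continuous_real continuous_intros) auto
  finally have "ennreal (norm (f z)) \<le> ennreal (integral {0..1} (\<lambda>t. norm (f (z + cis (2 * pi * t) * \<zeta>))))"
    by (simp add: ennreal_leI)
  also have "\<dots> = (\<integral>\<^sup>+t. ennreal (norm (f (z + cis (2 * pi * t) * \<zeta>))) * indicator {0..1} t \<partial>lborel)"
    by (rule nn_integral_has_integral_lebesgue'[symmetric])
       (use cont in \<open>auto intro!: integrable_integral integrable_continuous_real continuous_intros\<close>)
  finally show ?thesis .
qed

lemma emeasure_ball_complex: "r \<ge> 0 \<Longrightarrow> emeasure lborel (ball (z::complex) r) = ennreal (pi * r\<^sup>2)"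
  by (simp add: emeasure_ball unit_ball_vol_2)

lemma borel_measurable_indicator_holomorphic:
  fixes f :: "complex \<Rightarrow> complex"
  assumes "continuous_on S f" "S \<in> sets borel"
  shows "(\<lambda>z. indicator S z * ennreal (norm (f z) powr p)) \<in> borel_measurable borel"
proof -
  have "(\<lambda>z. indicator S z *\<^sub>R f z) \<in> borel_measurable borel"
    using borel_measurable_continuous_on_indicator[OF assms(2,1)] .
  then have [measurable]: "(\<lambda>z. norm (indicator S z *\<^sub>R f z) powr p) \<in> borel_measurable borel"
    by measurable
  have "(\<lambda>z. indicator S z * ennreal (norm (f z) powr p)) = (\<lambda>z. indicator S z * ennreal (norm (indicator S z *\<^sub>R f z) powr p))"
    by (auto simp: indicator_def fun_eq_iff)
  also have "\<dots> \<in> borel_measurable borel"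
    using assms(2) by measurable
  finally show ?thesis .
qed

text \<open>This avoids polar coordinates. The circle inequality is integrated over all
  \<open>\<zeta>\<close> in the ball; after exchanging the integrals, rotation and translation
  invariance make the inner integral the same for every angle \<open>t\<close>.\<close>

lemma area_mean_value_le:
  assumes hol: "f holomorphic_on S" and S: "open S" "ball z r \<subseteq> S" and r: "r \<ge> 0"
  shows "ennreal (norm (f z)) * ennreal (pi * r\<^sup>2) \<le> (\<integral>\<^sup>+w. indicator (ball z r) w * ennreal (norm (f w)) \<partial>lborel)"
proof -
  have hol': "f holomorphic_on ball z r"
    using hol S by (auto intro: holomorphic_on_subset)
  define h where "h w = indicator (ball z r) w * ennreal (norm (f w))" for w
  have [measurable]: "h \<in> borel_measurable borel"
    using borel_measurable_indicator_holomorphic[of "ball z r" f 1] holomorphic_on_imp_continuous_on[OF hol']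
    by (simp add: h_def[abs_def])
  have inv: "(\<integral>\<^sup>+\<zeta>. h (z + c * \<zeta>) \<partial>lborel) = (\<integral>\<^sup>+w. h w \<partial>lborel)" if "norm c = 1" for c
  proof -
    have "(\<integral>\<^sup>+\<zeta>. h (z + c * \<zeta>) \<partial>lborel) = (\<integral>\<^sup>+\<zeta>. h (z + \<zeta>) \<partial>lborel)"
      using that by (intro nn_integral_rotate[where h = "\<lambda>w. h (z + w)"]) auto
    also have "\<dots> = (\<integral>\<^sup>+w. h w \<partial>lborel)"
      by (subst (2) lborel_distr_plus[of z, symmetric], subst nn_integral_distr) auto
    finally show ?thesis .
  qed
  have "ennreal (norm (f z)) * ennreal (pi * r\<^sup>2) = (\<integral>\<^sup>+\<zeta>. ennreal (norm (f z)) * indicator (ball (0::complex) r) \<zeta> \<partial>lborel)"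
    using r by (subst nn_integral_cmult_indicator) (simp_all add: emeasure_ball_complex)
  also have "\<dots> \<le> (\<integral>\<^sup>+\<zeta>. \<integral>\<^sup>+t. h (z + cis (2 * pi * t) * \<zeta>) * indicator {0..1} t \<partial>lborel \<partial>lborel)"
  proof (intro nn_integral_mono)
    fix \<zeta> :: complex
    show "ennreal (norm (f z)) * indicator (ball 0 r) \<zeta> \<le>
      (\<integral>\<^sup>+t. h (z + cis (2 * pi * t) * \<zeta>) * indicator {0..1} t \<partial>lborel)"
    proof (cases "\<zeta> \<in> ball 0 r")
      case True
      then have "ennreal (norm (f z)) \<le> (\<integral>\<^sup>+t. ennreal (norm (f (z + cis (2 * pi * t) * \<zeta>))) * indicator {0..1} t \<partial>lborel)"
        by (intro mean_value_circle_le[OF hol']) auto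
      also have "\<dots> = (\<integral>\<^sup>+t. h (z + cis (2 * pi * t) * \<zeta>) * indicator {0..1} t \<partial>lborel)"
        using True by (intro nn_integral_cong) (auto simp: h_def dist_norm norm_mult)
      finally show ?thesis
        using True by simp
    qed simp
  qed
  also have "\<dots> = (\<integral>\<^sup>+t. \<integral>\<^sup>+\<zeta>. h (z + cis (2 * pi * t) * \<zeta>) * indicator {0..1} t \<partial>lborel \<partial>lborel)"
  proof (rule lborel_pair.Fubini'[symmetric])
    have [measurable]: "(\<lambda>x::complex \<times> real. cis (2 * pi * snd x)) \<in> borel_measurable (lborel \<Otimes>\<^sub>M lborel)"
      unfolding cis.ctr by measurable
    show "(\<lambda>(\<zeta>, t). h (z + cis (2 * pi * t) * \<zeta>) * indicator {0..1} t) \<in> borel_measurable (lborel \<Otimes>\<^sub>M lborel)"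
      unfolding split_beta' by measurable
  qed
  also have "\<dots> = (\<integral>\<^sup>+t. (\<integral>\<^sup>+w. h w \<partial>lborel) * indicator {0..1} (t::real) \<partial>lborel)"
    by (intro nn_integral_cong, subst nn_integral_multc) (auto simp: inv)
  also have "\<dots> = (\<integral>\<^sup>+w. h w \<partial>lborel)"
    by (simp add: nn_integral_cmult)
  finally show ?thesis
    by (simp add: h_def)
qed

section \<open>The sub-mean value property\<close>

text \<open>In place of Jensen's inequality, \<open>norm f\<close> is cut at the level
  \<open>l\<close>, half of \<open>norm (f z)\<close>. Values up to \<open>l\<close> contribute at
  most half of the left-hand side and are absorbed; above \<open>l\<close>, \<open>norm f\<close> is
  at most \<open>l powr (1 - p) * norm f powr p\<close>.\<close>

lemma submean_powr_ge_1:
  assumes p: "p \<ge> 1"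
    and hol: "f holomorphic_on S" and S: "open S" "cball z r \<subseteq> S" and r: "r > 0"
  shows "ennreal (norm (f z) powr p * r\<^sup>2) \<le>
     ennreal (2 powr p) * (\<integral>\<^sup>+w. indicator (ball z r) w * ennreal (norm (f w) powr p) \<partial>lborel)"
proof (cases "f z = 0 \<or> (\<integral>\<^sup>+w. indicator (ball z r) w * ennreal (norm (f w) powr p) \<partial>lborel) = top")
  case True
  then show ?thesis
    by (auto simp: ennreal_mult_eq_top_iff ennreal_mult_top)
next
  case False
  then obtain j where j: "(\<integral>\<^sup>+w. indicator (ball z r) w * ennreal (norm (f w) powr p) \<partial>lborel) = ennreal j" "j \<ge> 0"
    by (cases "\<integral>\<^sup>+w. indicator (ball z r) w * ennreal (norm (f w) powr p) \<partial>lborel") auto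
  define m where "m = norm (f z)"
  define l where "l = m / 2"
  have m: "m > 0" and l: "l > 0"
    using False by (auto simp: m_def l_def)
  have hol': "f holomorphic_on ball z r"
    using hol S by (auto intro: holomorphic_on_subset dest: ball_subset_cball[THEN subsetD])
  note [measurable] = borel_measurable_indicator_holomorphic[OF holomorphic_on_imp_continuous_on[OF hol'], of p]
  have pt: "norm (f w) \<le> l + l powr (1 - p) * norm (f w) powr p" for w
  proof (cases "norm (f w) \<le> l")
    case True
    then show ?thesis
      by (simp add: add_increasing2)
  next
    case False
    then have pos: "norm (f w) > 0" using l by linarith
    have "norm (f w) = norm (f w) powr (1 - p) * norm (f w) powr p"
      using pos by (simp flip: powr_add)
    also have "\<dots> \<le> l powr (1 - p) * norm (f w) powr p"
      using False p l by (intro mult_right_mono powr_mono2') auto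
    finally show ?thesis
      using l by linarith
  qed
  have ind: "(\<lambda>w. ennreal l * indicator (ball z r) w) \<in> borel_measurable borel"
    by (intro borel_measurable_times_ennreal borel_measurable_indicator) auto
  have "ennreal (m * (pi * r\<^sup>2)) = ennreal (norm (f z)) * ennreal (pi * r\<^sup>2)"
    by (simp add: m_def ennreal_mult)
  also have "\<dots> \<le> (\<integral>\<^sup>+w. indicator (ball z r) w * ennreal (norm (f w)) \<partial>lborel)"
    using r S by (intro area_mean_value_le[OF hol]) (auto dest: ball_subset_cball[THEN subsetD])
  also have "\<dots> \<le> (\<integral>\<^sup>+w. ennreal l * indicator (ball z r) w +
      ennreal (l powr (1 - p)) * (indicator (ball z r) w * ennreal (norm (f w) powr p)) \<partial>lborel)"
    using pt l by (intro nn_integral_mono) (auto simp: indicator_def simp flip: ennreal_mult ennreal_plus intro!: ennreal_leI)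
  also have "\<dots> = ennreal l * ennreal (pi * r\<^sup>2) + ennreal (l powr (1 - p)) * ennreal j"
    using r ind by (subst nn_integral_add) (simp_all add: nn_integral_cmult j emeasure_ball_complex nn_integral_cmult_indicator)
  also have "\<dots> = ennreal (l * (pi * r\<^sup>2) + l powr (1 - p) * j)"
    using l j by (simp flip: ennreal_mult ennreal_plus)
  finally have "m * (pi * r\<^sup>2) \<le> l * (pi * r\<^sup>2) + l powr (1 - p) * j"
    using l j by (subst (asm) ennreal_le_iff) auto
  then have "l * (pi * r\<^sup>2) \<le> l powr (1 - p) * j"
    by (simp add: l_def field_simps)
  then have "l powr (p - 1) * (l * (pi * r\<^sup>2)) \<le> l powr (p - 1) * (l powr (1 - p) * j)"
    by (intro mult_left_mono) auto
  also have "\<dots> = j"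
    using l by (simp flip: mult.assoc powr_add)
  also have "l powr (p - 1) * (l * (pi * r\<^sup>2)) = l powr p * (pi * r\<^sup>2)"
    using l by (simp add: powr_diff)
  finally have "l powr p * (pi * r\<^sup>2) \<le> j" .
  moreover have "l powr p * (1 * r\<^sup>2) \<le> l powr p * (pi * r\<^sup>2)"
    using pi_gt3 by (intro mult_left_mono mult_right_mono) auto
  ultimately have "2 powr p * (l powr p * r\<^sup>2) \<le> 2 powr p * j"
    by simp
  moreover have "m powr p = 2 powr p * l powr p"
    using m by (simp add: l_def flip: powr_mult)
  ultimately have "m powr p * r\<^sup>2 \<le> 2 powr p * j"
    by (simp add: mult.assoc)
  then have "ennreal (norm (f z) powr p * r\<^sup>2) \<le> ennreal (2 powr p * j)"
    by (intro ennreal_leI) (simp add: m_def)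
  then show ?thesis
    using j by (simp add: ennreal_mult)
qed

text \<open>
  The maximum \<open>s\<close> of the weighted modulus satisfies an estimate with \<open>s powr (1 - p)\<close> on the
  right-hand side, which can be cancelled since \<open>s\<close> is finite.
\<close>

lemma submean_powr_less_1:
  assumes p: "0 < p" "p < 1"
    and hol: "f holomorphic_on S" and S: "open S" "cball z r \<subseteq> S" and r: "r > 0"
  shows "ennreal (norm (f z) powr p * r\<^sup>2) \<le>
     ennreal (2 powr (2 / p)) * (\<integral>\<^sup>+w. indicator (ball z r) w * ennreal (norm (f w) powr p) \<partial>lborel)"
proof (cases "f z = 0 \<or> (\<integral>\<^sup>+w. indicator (ball z r) w * ennreal (norm (f w) powr p) \<partial>lborel) = top")
  case True
  then show ?thesis
    by (auto simp: ennreal_mult_eq_top_iff ennreal_mult_top)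
next
  case False
  then obtain j where j: "(\<integral>\<^sup>+w. indicator (ball z r) w * ennreal (norm (f w) powr p) \<partial>lborel) = ennreal j" "j \<ge> 0"
    by (cases "\<integral>\<^sup>+w. indicator (ball z r) w * ennreal (norm (f w) powr p) \<partial>lborel") auto
  have hol': "f holomorphic_on ball z r"
    using hol S by (auto intro: holomorphic_on_subset dest: ball_subset_cball[THEN subsetD])
  note [measurable] = borel_measurable_indicator_holomorphic[OF holomorphic_on_imp_continuous_on[OF hol'], of p]
  \<comment> \<open>The exponent makes \<open>\<phi> z powr p\<close> equal to
    \<open>norm (f z) powr p * r\<^sup>2\<close>, the quantity to be bounded. The weight vanishes on
    the boundary circle, so a maximum with positive value is attained inside.\<close>
  define \<phi> where "\<phi> w = (r - dist w z) powr (2 / p) * norm (f w)" for w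
  have contf: "continuous_on (cball z r) f"
    using holomorphic_on_imp_continuous_on[OF hol] S by (auto intro: continuous_on_subset)
  have "continuous_on (cball z r) \<phi>"
    unfolding \<phi>_def using p
    by (intro continuous_intros continuous_on_powr' contf) (auto simp: dist_commute)
  then obtain w0 where w0: "w0 \<in> cball z r" and max: "\<And>w. w \<in> cball z r \<Longrightarrow> \<phi> w \<le> \<phi> w0"
    using continuous_attains_sup[of "cball z r" \<phi>] r by auto
  define s where "s = \<phi> w0"
  have "0 < \<phi> z"
    using False r by (simp add: \<phi>_def)
  also have zs: "\<phi> z \<le> s"
    using max[of z] r by (simp add: s_def)
  finally have s: "s > 0" .
  \<comment> \<open>Half the distance from \<open>w0\<close> to the circle: on
    \<open>ball w0 d\<close> the weight is still at least \<open>d powr (2 / p)\<close>, so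
    maximality gives \<open>norm (f w) \<le> s * d powr (- 2 / p)\<close>. The constant
    \<open>K\<close> below is this bound raised to the power \<open>1 - p\<close>.\<close>
  define d where "d = (r - dist w0 z) / 2"
  have "r - dist w0 z \<noteq> 0"
    using s by (auto simp: s_def \<phi>_def)
  then have d: "d > 0"
    using w0 by (auto simp: d_def dist_commute)
  have sub: "ball w0 d \<subseteq> ball z r"
  proof
    fix w assume "w \<in> ball w0 d"
    then have "dist z w < dist w0 z + d"
      using dist_triangle[of z w w0] by (simp add: dist_commute)
    also have "\<dots> < r"
      using d by (simp add: d_def field_simps)
    finally show "w \<in> ball z r" by simp
  qed
  define K where "K = (s * d powr (- 2 / p)) powr (1 - p)"
  have pt: "norm (f w) \<le> K * norm (f w) powr p" if w: "w \<in> ball w0 d" for w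
  proof (cases "f w = 0")
    case False
    have "dist w z \<le> dist w0 z + d"
      using w dist_triangle[of w z w0] by (simp add: dist_commute)
    then have "d \<le> r - dist w z"
      unfolding d_def by argo
    then have "d powr (2 / p) * norm (f w) \<le> \<phi> w"
      unfolding \<phi>_def using d p by (intro mult_right_mono powr_mono2) auto
    also have "\<dots> \<le> s"
      unfolding s_def using w sub by (intro max) auto
    finally have le: "norm (f w) \<le> s * d powr (- 2 / p)"
      using d by (simp add: powr_minus field_simps)
    have "norm (f w) = norm (f w) powr (1 - p) * norm (f w) powr p"
      using False by (simp flip: powr_add)
    also have "\<dots> \<le> K * norm (f w) powr p"
      unfolding K_def using le p by (intro mult_right_mono powr_mono2) auto
    finally show ?thesis .
  qed simp
  have "ennreal (norm (f w0) * (pi * d\<^sup>2)) = ennreal (norm (f w0)) * ennreal (pi * d\<^sup>2)"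
    by (simp add: ennreal_mult)
  also have "\<dots> \<le> (\<integral>\<^sup>+w. indicator (ball w0 d) w * ennreal (norm (f w)) \<partial>lborel)"
    using d sub by (intro area_mean_value_le[OF hol']) auto
  also have "\<dots> \<le> (\<integral>\<^sup>+w. ennreal K * (indicator (ball z r) w * ennreal (norm (f w) powr p)) \<partial>lborel)"
    using pt sub by (intro nn_integral_mono)
      (auto simp: indicator_def K_def simp flip: ennreal_mult intro!: ennreal_leI)
  also have "\<dots> = ennreal K * ennreal j"
    by (simp add: nn_integral_cmult j)
  also have "\<dots> = ennreal (K * j)"
    using j by (simp add: K_def ennreal_mult)
  finally have "norm (f w0) * (pi * d\<^sup>2) \<le> K * j"
    using j by (subst (asm) ennreal_le_iff) (auto simp: K_def)
  also have "norm (f w0) = s * (2 * d) powr (- 2 / p)"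
  proof -
    have *: "r - dist w0 z = 2 * d"
      by (simp add: d_def)
    show ?thesis
      unfolding s_def \<phi>_def * using d by (simp add: powr_minus field_simps)
  qed
  \<comment> \<open>Written this way, both sides of the inequality carry the factor
    \<open>d powr (- 2 / p) * d\<^sup>2\<close>, so that the uncontrolled distance \<open>d\<close>
    cancels.\<close>
  also have "K = s powr (1 - p) * (d powr (- 2 / p) * d\<^sup>2)"
  proof -
    have "(d powr (- 2 / p)) powr (1 - p) = d powr (- 2 / p + 2)"
    proof -
      have "- 2 / p * (1 - p) = - 2 / p + 2"
        using p by (simp add: field_simps)
      then show ?thesis
        by (simp only: powr_powr)
    qed
    also have "\<dots> = d powr (- 2 / p) * d\<^sup>2"
      using d powr_add[of d "- 2 / p" 2] by (simp only: powr_numeral)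
    finally show ?thesis
      using s by (simp add: K_def powr_mult)
  qed
  also have "s * (2 * d) powr (- 2 / p) * (pi * d\<^sup>2) = (s * 2 powr (- 2 / p) * pi) * (d powr (- 2 / p) * d\<^sup>2)"
    using d by (simp add: powr_mult)
  also have "s powr (1 - p) * (d powr (- 2 / p) * d\<^sup>2) * j = (s powr (1 - p) * j) * (d powr (- 2 / p) * d\<^sup>2)"
    by simp
  finally have "s * 2 powr (- 2 / p) * pi \<le> s powr (1 - p) * j"
    using d by (subst (asm) mult_le_cancel_right) auto
  then have "s powr (p - 1) * (s * 2 powr (- 2 / p) * pi) \<le> s powr (p - 1) * (s powr (1 - p) * j)"
    by (intro mult_left_mono) auto
  also have "\<dots> = j"
    using s by (simp flip: mult.assoc powr_add)
  also have "s powr (p - 1) * (s * 2 powr (- 2 / p) * pi) = s powr p * 2 powr (- 2 / p) * pi"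
    using s by (simp add: powr_diff)
  finally have "s powr p * 2 powr (- 2 / p) * pi \<le> j" .
  moreover have "s powr p * 2 powr (- 2 / p) * 1 \<le> s powr p * 2 powr (- 2 / p) * pi"
    using pi_gt3 by (intro mult_left_mono) auto
  ultimately have "s powr p \<le> 2 powr (2 / p) * j"
    by (simp add: powr_minus field_simps)
  moreover have "norm (f z) powr p * r\<^sup>2 = \<phi> z powr p"
    using r p by (simp add: \<phi>_def powr_mult powr_powr powr_numeral)
  moreover have "\<phi> z powr p \<le> s powr p"
    using zs p by (intro powr_mono2) (auto simp: \<phi>_def)
  ultimately have "ennreal (norm (f z) powr p * r\<^sup>2) \<le> ennreal (2 powr (2 / p) * j)"
    by (intro ennreal_leI) simp
  then show ?thesis
    using j by (simp add: ennreal_mult)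
qed

lemma submean_powr:
  assumes p: "0 < p"
    and hol: "f holomorphic_on S" and S: "open S" "cball z r \<subseteq> S" and r: "r > 0"
  shows "ennreal (norm (f z) powr p * r\<^sup>2) \<le>
     ennreal (2 powr p + 2 powr (2 / p)) * (\<integral>\<^sup>+w. indicator (ball z r) w * ennreal (norm (f w) powr p) \<partial>lborel)"
proof (cases "p < 1")
  case True
  show ?thesis
    by (rule order_trans[OF submean_powr_less_1[OF p True hol S r]])
       (auto intro!: mult_right_mono ennreal_leI)
next
  case False
  then show ?thesis
    by (intro order_trans[OF submean_powr_ge_1[OF _ hol S r]]) (auto intro!: mult_right_mono ennreal_leI)
qed

text \<open>Cauchy's inequality is applied on the circle of radius \<open>r\<close>. The sub-mean
  value property bounds \<open>f\<close> at each point of that circle by an integral over a ball of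
  radius \<open>r\<close>, which lies in the ball of radius \<open>2 * r\<close> around
  \<open>z\<close>.\<close>

lemma kderiv_powr_bound:
  assumes p: "0 < p"
    and hol: "f holomorphic_on S" and S: "open S" "cball z (2 * r) \<subseteq> S" and r: "r > 0"
  shows "ennreal (norm (kderiv k f z) powr p * r powr (real k * p + 2)) \<le>
     ennreal (fact k powr p * (2 powr p + 2 powr (2 / p))) *
       (\<integral>\<^sup>+w. indicator (ball z (2 * r)) w * ennreal (norm (f w) powr p) \<partial>lborel)"
proof (cases "(\<integral>\<^sup>+w. indicator (ball z (2 * r)) w * ennreal (norm (f w) powr p) \<partial>lborel) = top")
  case True
  moreover have "0 < (2::real) powr p + 2 powr (2 / p)"
    by (simp add: add_pos_pos)
  ultimately show ?thesis
    by (simp add: ennreal_mult_eq_top_iff ennreal_mult_top)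
next
  case False
  then obtain j where j: "(\<integral>\<^sup>+w. indicator (ball z (2 * r)) w * ennreal (norm (f w) powr p) \<partial>lborel) = ennreal j" "j \<ge> 0"
    by (cases "\<integral>\<^sup>+w. indicator (ball z (2 * r)) w * ennreal (norm (f w) powr p) \<partial>lborel") auto
  define C where "C = 2 powr p + 2 powr (2 / p)"
  have C: "C > 0" by (simp add: C_def add_pos_pos)
  define B where "B = (C * j / r\<^sup>2) powr (1 / p)"
  have bd: "norm (f w) \<le> B" if w: "norm (z - w) = r" for w
  proof -
    have sub: "cball w r \<subseteq> cball z (2 * r)" "ball w r \<subseteq> ball z (2 * r)"
      using w dist_triangle[of z _ w] by (auto simp: dist_norm) (smt (verit) dist_norm dist_triangle)+
    have "ennreal (norm (f w) powr p * r\<^sup>2) \<le>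
        ennreal C * (\<integral>\<^sup>+x. indicator (ball w r) x * ennreal (norm (f x) powr p) \<partial>lborel)"
      unfolding C_def using sub S r by (intro submean_powr[OF p hol]) auto
    also have "\<dots> \<le> ennreal C * ennreal j"
      unfolding j(1)[symmetric] using sub
      by (intro mult_left_mono nn_integral_mono) (auto simp: indicator_def)
    also have "\<dots> = ennreal (C * j)"
      using j C by (simp add: ennreal_mult)
    finally have "norm (f w) powr p * r\<^sup>2 \<le> C * j"
      using j C by (subst (asm) ennreal_le_iff) auto
    then have "norm (f w) powr p \<le> C * j / r\<^sup>2"
      using r by (simp add: field_simps)
    then have "(norm (f w) powr p) powr (1 / p) \<le> B"
      unfolding B_def using p by (intro powr_mono2) auto
    then show ?thesis
      using p by (simp add: powr_powr)
  qed
  have "cball z r \<subseteq> cball z (2 * r)"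
    using r by auto
  then have "f holomorphic_on cball z r"
    using hol S by (auto intro: holomorphic_on_subset)
  then have "norm (kderiv k f z) \<le> fact k * B / r ^ k"
    using r bd by (intro Cauchy_inequality)
      (auto intro: holomorphic_on_imp_continuous_on holomorphic_on_subset[OF _ ball_subset_cball])
  then have "norm (kderiv k f z) powr p \<le> (fact k * B / r ^ k) powr p"
    using p by (intro powr_mono2) auto
  also have "\<dots> = fact k powr p * (C * j / r\<^sup>2) / r powr (real k * p)"
    using p r C j
    by (simp add: powr_mult powr_divide B_def powr_powr) (simp add: powr_powr flip: powr_realpow)
  also have "\<dots> = fact k powr p * C * j / r powr (real k * p + 2)"
    using r by (simp add: powr_add powr_numeral mult_ac)
  finally have "norm (kderiv k f z) powr p * r powr (real k * p + 2) \<le> fact k powr p * C * j"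
    using r by (simp add: field_simps)
  then have "ennreal (norm (kderiv k f z) powr p * r powr (real k * p + 2)) \<le> ennreal (fact k powr p * C * j)"
    by (rule ennreal_leI)
  then show ?thesis
    using j C by (simp add: ennreal_mult C_def)
qed

section \<open>Test functions\<close>

lemma norm_1_minus_cnj_mult_ge:
  assumes "norm a < 1" "norm z < 1"
  shows "1 - norm a \<le> norm (1 - cnj a * z)"
proof -
  have "norm (cnj a * z) \<le> norm a * 1"
    unfolding norm_mult complex_mod_cnj using assms by (intro mult_left_mono) auto
  then show ?thesis
    using norm_triangle_ineq2[of 1 "cnj a * z"] by simp
qed

text \<open>The squares differ by \<open>(1 - (norm a)\<^sup>2) * (1 - (norm z)\<^sup>2)\<close>;
  this is the bound by 1 for the pseudohyperbolic distance.\<close>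

lemma norm_diff_le_1_minus_cnj_mult:
  assumes "norm a < 1" "norm z < 1"
  shows "norm (z - a) \<le> norm (1 - cnj a * z)"
proof -
  have "(norm (1 - cnj a * z))\<^sup>2 - (norm (z - a))\<^sup>2 = (1 - (norm a)\<^sup>2) * (1 - (norm z)\<^sup>2)"
    unfolding cmod_power2 by (simp add: power2_eq_square algebra_simps)
  also have "\<dots> \<ge> 0"
    using assms by (intro mult_nonneg_nonneg) (auto simp: power_le_one)
  finally show ?thesis
    by (auto intro: power2_le_imp_le)
qed

lemma one_minus_cnj_mult_nonzero:
  assumes "norm a < 1" "norm z < 1"
  shows "1 - cnj a * z \<noteq> 0"
  using norm_1_minus_cnj_mult_ge[OF assms] assms by auto

definition test_fun :: "nat \<Rightarrow> complex \<Rightarrow> nat \<Rightarrow> complex \<Rightarrow> complex" where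
  "test_fun N a i z = ((z - a) / of_real (1 - norm a)) ^ i * (of_real (1 - norm a) / (1 - cnj a * z)) ^ N"

lemma holomorphic_test_fun:
  assumes "norm a < 1"
  shows "test_fun N a i holomorphic_on disc"
  unfolding test_fun_def[abs_def] using assms one_minus_cnj_mult_nonzero[OF assms]
  by (intro holomorphic_intros) (simp_all add: disc_def flip: of_real_diff)

text \<open>With \<open>t\<close> the quotient on the right, \<open>t \<le> 1\<close> and the factor
  with exponent \<open>i\<close> costs at most \<open>(1 / t) ^ i\<close>. The \<open>n\<close>
  extra powers of the kernel pay for this whatever \<open>i\<close> is, leaving \<open>m\<close> of
  them for decay.\<close>

lemma norm_test_fun_le:
  assumes a: "norm a < 1" and z: "norm z < 1" and i: "i \<le> n"
  shows "norm (test_fun (n + m) a i z) \<le> ((1 - norm a) / norm (1 - cnj a * z)) ^ m"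
proof -
  define t where "t = (1 - norm a) / norm (1 - cnj a * z)"
  have ge: "1 - norm a \<le> norm (1 - cnj a * z)"
    by (rule norm_1_minus_cnj_mult_ge[OF a z])
  then have pos: "norm (1 - cnj a * z) > 0"
    using a by linarith
  have t: "0 < t" "t \<le> 1"
    using a ge pos by (simp_all add: t_def)
  have "norm (test_fun (n + m) a i z) = (norm (z - a) / (1 - norm a)) ^ i * t ^ (n + m)"
    using a by (simp add: test_fun_def norm_mult norm_power norm_divide t_def flip: of_real_diff)
  also have "\<dots> \<le> (1 / t) ^ i * t ^ (n + m)"
    using norm_diff_le_1_minus_cnj_mult[OF a z] a t unfolding t_def
    by (intro mult_right_mono power_mono divide_right_mono) (auto simp: divide_right_mono)
  also have "\<dots> = t ^ (n + m - i)"
    using t i by (simp add: power_diff field_simps)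
  also have "\<dots> \<le> t ^ m"
    using t i by (intro power_decreasing) auto
  finally show ?thesis
    by (simp add: t_def)
qed

text \<open>The fourth power makes the dyadic sum for the integral over the disc converge. The same
  condition on \<open>m\<close> later makes the functions, divided by \<open>d powr (2 / p)\<close>,
  tend to 0 on compact sets.\<close>

lemma norm_test_fun_powr_le:
  assumes a: "norm a < 1" and z: "norm z < 1" and i: "i \<le> n" and p: "p > 0" and m: "real m * p \<ge> 4"
  shows "norm (test_fun (n + m) a i z) powr p \<le> ((1 - norm a) / norm (1 - cnj a * z)) ^ 4"
proof -
  define t where "t = (1 - norm a) / norm (1 - cnj a * z)"
  have ge: "1 - norm a \<le> norm (1 - cnj a * z)"
    by (rule norm_1_minus_cnj_mult_ge[OF a z])
  then have pos: "norm (1 - cnj a * z) > 0"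
    using a by linarith
  have t: "0 < t" "t \<le> 1"
    using a ge pos by (simp_all add: t_def)
  have "norm (test_fun (n + m) a i z) powr p \<le> (t ^ m) powr p"
    using norm_test_fun_le[OF a z i, of m] p unfolding t_def by (intro powr_mono2) auto
  also have "\<dots> = t powr (real m * p)"
    using t by (simp add: powr_powr flip: powr_realpow)
  also have "\<dots> \<le> t powr 4"
    using t m by (intro powr_mono') auto
  also have "\<dots> = t ^ 4"
    using t by (simp add: powr_numeral)
  finally show ?thesis
    by (simp add: t_def)
qed

text \<open>Since \<open>1 - cnj a * z\<close> is \<open>cnj a\<close> times the difference of
  \<open>1 / cnj a\<close> and \<open>z\<close>, its sublevel sets lie in balls around
  \<open>1 / cnj a\<close> as long as \<open>norm a\<close> is not small. For
  \<open>norm a < 1 / 2\<close> the radius \<open>2 * R\<close> exceeds 1, and a ball around 0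
  contains the disc.\<close>

lemma ball_cover_of_1_minus_cnj_mult:
  assumes a: "norm a < 1"
  obtains c where "\<And>z R. norm z < 1 \<Longrightarrow> R \<ge> 1 - norm a \<Longrightarrow> norm (1 - cnj a * z) < R \<Longrightarrow> z \<in> ball c (2 * R)"
proof (cases "norm a \<ge> 1 / 2")
  case True
  then have a0: "a \<noteq> 0" by auto
  show ?thesis
  proof (rule that[of "1 / cnj a"])
    fix z R assume *: "norm (1 - cnj a * z) < R"
    have "1 - cnj a * z = cnj a * (1 / cnj a - z)"
      using a0 by (simp add: field_simps)
    then have "norm (1 - cnj a * z) = norm a * dist (1 / cnj a) z"
      by (simp add: norm_mult dist_norm)
    moreover have "1 / 2 * dist (1 / cnj a) z \<le> norm a * dist (1 / cnj a) z"
      using True by (intro mult_right_mono) auto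
    ultimately show "z \<in> ball (1 / cnj a) (2 * R)"
      using * by simp
  qed
next
  case False
  then show ?thesis
    by (intro that[of 0]) auto
qed

text \<open>
  Decompose dyadically according to the size of the quotient \<open>norm (1 - cnj a * z) / (1 - norm a)\<close>.
\<close>

lemma nn_integral_kernel_le:
  assumes a: "norm a < 1"
  shows "(\<integral>\<^sup>+z. indicator disc z * ennreal (((1 - norm a) / norm (1 - cnj a * z)) ^ 4) \<partial>lborel)
     \<le> ennreal (pi * (86 * (1 - norm a)\<^sup>2))"
proof -
  define d where "d = 1 - norm a"
  have d: "d > 0" using a by (simp add: d_def)
  obtain c where c: "\<And>z R. norm z < 1 \<Longrightarrow> R \<ge> d \<Longrightarrow> norm (1 - cnj a * z) < R \<Longrightarrow> z \<in> ball c (2 * R)"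
    unfolding d_def using ball_cover_of_1_minus_cnj_mult[OF a] by metis
  have "(\<integral>\<^sup>+z. indicator disc z * ennreal ((d / norm (1 - cnj a * z)) ^ 4) \<partial>lborel)
      \<le> (\<integral>\<^sup>+z. (\<Sum>k. ennreal (16 / 16 ^ k) * indicator (ball c (2 * (2 ^ k * d))) z) \<partial>lborel)"
  proof (rule nn_integral_mono)
    fix z
    show "indicator disc z * ennreal ((d / norm (1 - cnj a * z)) ^ 4) \<le>
      (\<Sum>k. ennreal (16 / 16 ^ k) * indicator (ball c (2 * (2 ^ k * d))) z)"
    proof (cases "z \<in> disc")
      case True
      then have z: "norm z < 1" by (simp add: disc_def)
      define s where "s = norm (1 - cnj a * z) / d"
      have s: "s \<ge> 1"
        using norm_1_minus_cnj_mult_ge[OF a z] d by (simp add: s_def d_def)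
      \<comment> \<open>The index of the dyadic shell of \<open>z\<close>. It is not 0 because
        \<open>s \<ge> 1\<close>, so \<open>s\<close> is at least \<open>2 ^ (k - 1)\<close> and the
        kernel at most \<open>16 / 16 ^ k\<close>. This single term of the series already
        dominates.\<close>
      define k where "k = (LEAST k. s < 2 ^ k)"
      obtain k' where "s < 2 ^ k'"
        using real_arch_pow[of 2 s] by auto
      then have k: "s < 2 ^ k"
        unfolding k_def by (rule LeastI)
      have "k \<noteq> 0"
        using k s by (intro notI) auto
      then obtain l where l: "k = Suc l"
        by (cases k) auto
      have "\<not> s < 2 ^ l"
        using not_less_Least[of l "\<lambda>k. s < 2 ^ k"] l unfolding k_def by simp
      then have "(1 / s) ^ 4 \<le> (1 / 2 ^ l) ^ 4"
        using s by (intro power_mono frac_le) auto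
      also have "\<dots> = 16 / 16 ^ k"
        using power_mult[of "2::real" l 4] power_mult[of "2::real" 4 l]
        by (simp add: l power_divide mult.commute)
      also have "1 / s = d / norm (1 - cnj a * z)"
        by (simp add: s_def)
      finally have 1: "(d / norm (1 - cnj a * z)) ^ 4 \<le> 16 / 16 ^ k" .
      have "z \<in> ball c (2 * (2 ^ k * d))"
        using k d by (intro c z) (auto simp: s_def field_simps)
      then have "indicator disc z * ennreal ((d / norm (1 - cnj a * z)) ^ 4) \<le>
          (\<Sum>k\<in>{k}. ennreal (16 / 16 ^ k) * indicator (ball c (2 * (2 ^ k * d))) z)"
        using True 1 by (simp add: ennreal_leI)
      also have "\<dots> \<le> (\<Sum>k. ennreal (16 / 16 ^ k) * indicator (ball c (2 * (2 ^ k * d))) z)"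
        by (intro sum_le_suminf) auto
      finally show ?thesis .
    qed simp
  qed
  also have "\<dots> = (\<Sum>k. \<integral>\<^sup>+z. ennreal (16 / 16 ^ k) * indicator (ball c (2 * (2 ^ k * d))) z \<partial>lborel)"
    by (intro nn_integral_suminf borel_measurable_times_ennreal borel_measurable_indicator) auto
  also have "\<dots> = (\<Sum>k. ennreal (64 * pi * d\<^sup>2 * (1 / 4) ^ k))"
  proof (intro suminf_cong)
    fix k
    have "16 / 16 ^ k * (pi * (2 * (2 ^ k * d))\<^sup>2) = 64 * pi * d\<^sup>2 * (1 / 4) ^ k"
    proof -
      have 1: "(2 ^ k)\<^sup>2 = (4::real) ^ k"
        using power_mult[of "2::real" k 2] power_mult[of "2::real" 2 k] by (simp add: mult.commute)
      have 2: "(16::real) ^ k = 4 ^ k * 4 ^ k"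
        by (simp flip: power_mult_distrib)
      show ?thesis
        by (simp add: power_mult_distrib power_divide 1 2)
    qed
    then show "(\<integral>\<^sup>+z. ennreal (16 / 16 ^ k) * indicator (ball c (2 * (2 ^ k * d))) z \<partial>lborel) =
        ennreal (64 * pi * d\<^sup>2 * (1 / 4) ^ k)"
      using d by (subst nn_integral_cmult_indicator) (simp_all add: emeasure_ball_complex flip: ennreal_mult)
  qed
  also have "\<dots> = ennreal (64 * pi * d\<^sup>2 * (1 / (1 - 1 / 4)))"
    by (intro suminf_ennreal_eq sums_mult geometric_sums) auto
  \<comment> \<open>The geometric series gives \<open>64 * 4 / 3\<close>, which is below 86.\<close>
  also have "\<dots> \<le> ennreal (pi * (86 * d\<^sup>2))"
    by (intro ennreal_leI) simp
  finally show ?thesis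
    by (simp add: d_def)
qed

lemma test_fun_bergman:
  assumes a: "norm a < 1" and i: "i \<le> n" and p: "p > 0" and m: "real m * p \<ge> 4"
  shows "bergman_pnorm_pow p (test_fun (n + m) a i) \<le> ennreal (86 * (1 - norm a)\<^sup>2)"
    and "test_fun (n + m) a i \<in> bergman_space p"
proof -
  have "(\<integral>\<^sup>+z. indicator disc z * ennreal (norm (test_fun (n + m) a i z) powr p) \<partial>lborel)
      \<le> (\<integral>\<^sup>+z. indicator disc z * ennreal (((1 - norm a) / norm (1 - cnj a * z)) ^ 4) \<partial>lborel)"
    using norm_test_fun_powr_le[OF a _ i p m]
    by (intro nn_integral_mono) (auto simp: indicator_def disc_def intro!: ennreal_leI)
  also have "\<dots> \<le> ennreal (pi * (86 * (1 - norm a)\<^sup>2))"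
    by (rule nn_integral_kernel_le[OF a])
  finally have "bergman_pnorm_pow p (test_fun (n + m) a i) \<le> ennreal (pi * (86 * (1 - norm a)\<^sup>2)) / ennreal pi"
    unfolding bergman_pnorm_pow_def by (rule divide_right_mono_ennreal)
  also have "\<dots> = ennreal (86 * (1 - norm a)\<^sup>2)"
    by (simp add: divide_ennreal)
  finally show *: "bergman_pnorm_pow p (test_fun (n + m) a i) \<le> ennreal (86 * (1 - norm a)\<^sup>2)" .
  then show "test_fun (n + m) a i \<in> bergman_space p"
    using holomorphic_test_fun[OF a] by (auto simp: bergman_space_def intro: le_less_trans)
qed

section \<open>Recovering the coefficients from the test functions\<close>

lemma higher_deriv_sum:
  assumes "finite A" "\<And>i. i \<in> A \<Longrightarrow> f i holomorphic_on S" "open S" "z \<in> S"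
  shows "(deriv ^^ j) (\<lambda>w. \<Sum>i\<in>A. f i w) z = (\<Sum>i\<in>A. (deriv ^^ j) (f i) z)"
  using assms(1,2)
proof (induction A rule: finite_induct)
  case (insert x A)
  have "(deriv ^^ j) (\<lambda>w. f x w + (\<Sum>i\<in>A. f i w)) z = (deriv ^^ j) (f x) z + (deriv ^^ j) (\<lambda>w. \<Sum>i\<in>A. f i w) z"
    using insert.prems assms(3,4) by (intro higher_deriv_add holomorphic_on_sum) auto
  then show ?case
    using insert by simp
qed simp

text \<open>In Leibniz' formula only the term with exactly \<open>k\<close> derivatives on the power
  survives at its zero \<open>z\<close>.\<close>

lemma higher_deriv_power_mult_at_zero:
  assumes "g holomorphic_on S" "open S" "z \<in> S"
  shows "(deriv ^^ j) (\<lambda>w. (w - z) ^ k * g w) z =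
    (if k \<le> j then of_nat (j choose k) * fact k * (deriv ^^ (j - k)) g z else 0)"
proof -
  have *: "(deriv ^^ i) (\<lambda>w. (w - z) ^ k) z = (if i = k then fact k else 0)" for i
  proof (cases i k rule: linorder_cases)
    case less
    then show ?thesis by (simp add: higher_deriv_power)
  next
    case equal
    then show ?thesis by (simp add: higher_deriv_power pochhammer_fact)
  next
    case greater
    then show ?thesis by (simp add: higher_deriv_power pochhammer_0_left)
  qed
  have "(deriv ^^ j) (\<lambda>w. (w - z) ^ k * g w) z =
     (\<Sum>i = 0..j. of_nat (j choose i) * (deriv ^^ i) (\<lambda>w. (w - z) ^ k) z * (deriv ^^ (j - i)) g z)"
    using assms by (intro higher_deriv_mult[where S = S] holomorphic_intros)
  also have "\<dots> = (\<Sum>i = 0..j. if i = k then of_nat (j choose k) * fact k * (deriv ^^ (j - k)) g z else 0)"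
    by (intro sum.cong) (auto simp: *)
  finally show ?thesis
    by simp
qed

text \<open>
  For fixed \<open>z\<close>, the binomial theorem recombines the test functions into a function vanishing
  at \<open>z\<close> to order \<open>k\<close>. This removes the derivatives of order below \<open>k\<close>.
\<close>

lemma sum_kderiv_test_fun:
  assumes a: "norm a < 1" and z: "z \<in> disc"
  defines "d \<equiv> 1 - norm a"
  shows "(\<Sum>i\<le>k. of_nat (k choose i) * ((a - z) / of_real d) ^ (k - i) * kderiv j (test_fun N a i) z) =
    (if k \<le> j then of_nat (j choose k) * fact k / of_real d ^ k * kderiv (j - k) (test_fun N a 0) z else 0)"
proof -
  have d: "of_real d \<noteq> (0 :: complex)"
    using a by (auto simp: d_def simp flip: of_real_diff)
  have disc: "open disc"
    by (simp add: disc_def)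
  define c where "c i = of_nat (k choose i) * ((a - z) / of_real d) ^ (k - i)" for i
  have hol: "test_fun N a i holomorphic_on disc" for i
    by (rule holomorphic_test_fun[OF a])
  have "(\<Sum>i\<le>k. c i * kderiv j (test_fun N a i) z) = (\<Sum>i\<le>k. kderiv j (\<lambda>w. c i * test_fun N a i w) z)"
    using higher_deriv_cmult[OF hol z disc] by simp
  also have "\<dots> = kderiv j (\<lambda>w. \<Sum>i\<le>k. c i * test_fun N a i w) z"
    using z disc by (intro higher_deriv_sum[symmetric, where S = disc] holomorphic_intros hol) auto
  also have "(\<lambda>w. \<Sum>i\<le>k. c i * test_fun N a i w) = (\<lambda>w. 1 / of_real d ^ k * ((w - z) ^ k * test_fun N a 0 w))"
  proof
    fix w
    have t: "test_fun N a i w = ((w - a) / of_real d) ^ i * test_fun N a 0 w" for i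
      by (simp add: test_fun_def d_def)
    have "(\<Sum>i\<le>k. c i * test_fun N a i w) =
        (\<Sum>i\<le>k. of_nat (k choose i) * ((w - a) / of_real d) ^ i * ((a - z) / of_real d) ^ (k - i)) * test_fun N a 0 w"
      unfolding sum_distrib_right by (intro sum.cong refl) (subst t, simp add: c_def)
    also have "\<dots> = ((w - a) / of_real d + (a - z) / of_real d) ^ k * test_fun N a 0 w"
      by (simp add: binomial_ring)
    also have "(w - a) / of_real d + (a - z) / of_real d = (w - z) / of_real d"
      by (simp add: diff_divide_distrib)
    finally show "(\<Sum>i\<le>k. c i * test_fun N a i w) = 1 / of_real d ^ k * ((w - z) ^ k * test_fun N a 0 w)"
      by (simp add: power_divide)
  qed
  also have "kderiv j \<dots> z = 1 / of_real d ^ k * kderiv j (\<lambda>w. (w - z) ^ k * test_fun N a 0 w) z"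
    using disc z by (intro higher_deriv_cmult[where A = disc] holomorphic_intros hol)
  finally show ?thesis
    unfolding higher_deriv_power_mult_at_zero[OF hol disc z] by (simp add: c_def)
qed

text \<open>Row \<open>k\<close> of the triangular system, solved for its diagonal term. The
  recombination has removed the coefficients of index below \<open>k\<close>; those of index above
  \<open>k\<close> remain on the right.\<close>

lemma sobolev_op_test_fun:
  assumes a: "norm a < 1" and z: "z \<in> disc" and k: "k \<le> n"
  defines "d \<equiv> 1 - norm a"
  shows "fact k / of_real d ^ k * test_fun N a 0 z * u k z =
    (\<Sum>i\<le>k. of_nat (k choose i) * ((a - z) / of_real d) ^ (k - i) * sobolev_op n u (test_fun N a i) z) -
    (\<Sum>j\<in>{k<..n}. u j z * (of_nat (j choose k) * fact k / of_real d ^ k * kderiv (j - k) (test_fun N a 0) z))"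
proof -
  define c where "c i = of_nat (k choose i) * ((a - z) / of_real d) ^ (k - i)" for i
  define b where "b j = of_nat (j choose k) * fact k / of_real d ^ k * kderiv (j - k) (test_fun N a 0) z" for j
  have "(\<Sum>i\<le>k. c i * sobolev_op n u (test_fun N a i) z) =
      (\<Sum>i\<le>k. \<Sum>j\<le>n. c i * (u j z * kderiv j (test_fun N a i) z))"
    by (simp add: sobolev_op_def sum_distrib_left)
  also have "\<dots> = (\<Sum>j\<le>n. \<Sum>i\<le>k. c i * (u j z * kderiv j (test_fun N a i) z))"
    by (rule sum.swap)
  also have "\<dots> = (\<Sum>j\<le>n. u j z * (\<Sum>i\<le>k. c i * kderiv j (test_fun N a i) z))"
    by (simp add: sum_distrib_left mult_ac)
  also have "\<dots> = (\<Sum>j\<le>n. if k \<le> j then u j z * b j else 0)"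
    using sum_kderiv_test_fun[OF a z, of k, folded d_def]
    by (intro sum.cong refl) (simp add: c_def b_def)
  also have "\<dots> = (\<Sum>j\<in>{k..n}. u j z * b j)"
    by (simp add: sum.If_cases) (rule sum.cong; auto)
  also have "\<dots> = u k z * b k + (\<Sum>j\<in>{k<..n}. u j z * b j)"
    using k by (rule sum.head)
  finally show ?thesis
    by (simp add: c_def b_def)
qed

lemma norm_test_fun_0_ge:
  assumes a: "norm a < 1" and z: "z \<in> disc" and near: "norm (1 - cnj a * z) \<le> 4 * (1 - norm a)"
  shows "norm (test_fun N a 0 z) \<ge> 1 / 4 ^ N"
proof -
  have pos: "norm (1 - cnj a * z) > 0"
    using norm_1_minus_cnj_mult_ge[of a z] a z by (auto simp: disc_def)
  have "(1 / 4) ^ N \<le> ((1 - norm a) / norm (1 - cnj a * z)) ^ N"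
    using near pos by (intro power_mono) (auto simp: field_simps)
  also have "\<dots> = norm (test_fun N a 0 z)"
    using a by (simp add: test_fun_def norm_power norm_divide flip: of_real_diff)
  finally show ?thesis
    by (simp add: power_divide)
qed

text \<open>Cauchy's inequality is used on the circle of radius \<open>d / 2\<close> around
  \<open>z\<close>, where \<open>d = 1 - norm a\<close>. As \<open>z\<close> may be much closer to
  the unit circle than \<open>a\<close>, that circle can leave the disc. Holomorphy and the lower
  bound for \<open>1 - cnj a * w\<close> are therefore checked on \<open>cball z (d / 2)\<close>
  itself.\<close>

lemma norm_kderiv_test_fun_0_le:
  assumes a: "norm a < 1" and z: "z \<in> disc"
  shows "norm (kderiv l (test_fun N a 0) z) \<le> fact l * 2 ^ N * 2 ^ l / (1 - norm a) ^ l"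
proof -
  define d where "d = 1 - norm a"
  have d: "d > 0" using a by (simp add: d_def)
  have ge: "norm (1 - cnj a * w) \<ge> d / 2" if w: "w \<in> cball z (d / 2)" for w
  proof -
    have "norm (cnj a * (w - z)) \<le> 1 * (d / 2)"
      unfolding norm_mult complex_mod_cnj using w a by (intro mult_mono) (auto simp: dist_norm norm_minus_commute)
    moreover have "norm (1 - cnj a * z) \<ge> d"
      using norm_1_minus_cnj_mult_ge[of a z] a z by (auto simp: disc_def d_def)
    moreover have "1 - cnj a * w = (1 - cnj a * z) - cnj a * (w - z)"
      by (simp add: algebra_simps)
    then have "norm (1 - cnj a * w) \<ge> norm (1 - cnj a * z) - norm (cnj a * (w - z))"
      by (simp only: norm_triangle_ineq2)
    ultimately show ?thesis
      by linarith
  qed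
  have nz: "1 - cnj a * w \<noteq> 0" if "w \<in> cball z (d / 2)" for w
  proof
    assume "1 - cnj a * w = 0"
    with ge[OF that] d show False by simp
  qed
  have hol: "test_fun N a 0 holomorphic_on cball z (d / 2)"
    unfolding test_fun_def[abs_def] using nz a
    by (intro holomorphic_intros) (auto simp flip: of_real_diff)
  have "norm (test_fun N a 0 w) \<le> 2 ^ N" if "norm (z - w) = d / 2" for w
  proof -
    have "w \<in> cball z (d / 2)"
      using that by (simp add: dist_norm)
    from ge[OF this] have "d / norm (1 - cnj a * w) \<le> 2"
      using d by (cases "norm (1 - cnj a * w) = 0") (auto simp: field_simps)
    then have "(d / norm (1 - cnj a * w)) ^ N \<le> 2 ^ N"
      using d by (intro power_mono) auto
    then show ?thesis
      using d by (simp add: test_fun_def norm_power norm_divide flip: of_real_diff d_def)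
  qed
  then have "norm (kderiv l (test_fun N a 0) z) \<le> fact l * 2 ^ N / (d / 2) ^ l"
    using d by (intro Cauchy_inequality holomorphic_on_imp_continuous_on[OF hol]
        holomorphic_on_subset[OF hol ball_subset_cball]) auto
  then show ?thesis
    by (simp add: power_divide d_def)
qed

text \<open>The row of index \<open>k\<close> is divided by its diagonal coefficient, which has
  modulus at least \<open>1 / (d ^ k * 4 ^ N)\<close> near \<open>a\<close>, and the terms of higher
  index are bounded by the induction hypothesis.\<close>

lemma norm_coeff_le_step:
  fixes C :: "nat \<Rightarrow> real"
  assumes a: "norm a < 1" and z: "z \<in> disc" and near: "norm (1 - cnj a * z) \<le> 4 * (1 - norm a)"
    and k: "k \<le> n"
    and C: "\<And>j. k < j \<Longrightarrow> j \<le> n \<Longrightarrow> C j \<ge> 0"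
    and IH: "\<And>j. k < j \<Longrightarrow> j \<le> n \<Longrightarrow>
      norm (u j z) \<le> C j * (1 - norm a) ^ j * (\<Sum>i\<le>n. norm (sobolev_op n u (test_fun N a i) z))"
  shows "norm (u k z) \<le> 4 ^ N * (5 ^ k + (\<Sum>j\<in>{k<..n}. C j * (of_nat (j choose k) * fact k) * (fact (j - k) * 2 ^ N * 2 ^ (j - k)))) *
      (1 - norm a) ^ k * (\<Sum>i\<le>n. norm (sobolev_op n u (test_fun N a i) z))"
proof -
  define d where "d = 1 - norm a"
  have d: "d > 0" using a by (simp add: d_def)
  define s where "s = (\<Sum>i\<le>n. norm (sobolev_op n u (test_fun N a i) z))"
  have s: "s \<ge> 0" by (simp add: s_def sum_nonneg)
  define Q where "Q = 5 ^ k + (\<Sum>j\<in>{k<..n}. C j * (of_nat (j choose k) * fact k) * (fact (j - k) * 2 ^ N * 2 ^ (j - k)))"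
  define X where "X = (\<Sum>i\<le>k. of_nat (k choose i) * ((a - z) / of_real d) ^ (k - i) * sobolev_op n u (test_fun N a i) z)"
  define Y where "Y = (\<Sum>j\<in>{k<..n}. u j z * (of_nat (j choose k) * fact k / of_real d ^ k * kderiv (j - k) (test_fun N a 0) z))"
  have az: "norm (a - z) / d \<le> 4"
    using norm_diff_le_1_minus_cnj_mult[of a z] near a z d
    by (simp add: disc_def d_def norm_minus_commute divide_le_eq)
  have "norm X \<le> (\<Sum>i\<le>k. of_nat (k choose i) * (norm (a - z) / d) ^ (k - i) * s)"
    unfolding X_def
  proof (rule sum_norm_le)
    fix i assume i: "i \<in> {..k}"
    have "norm (sobolev_op n u (test_fun N a i) z) \<le> s"
      unfolding s_def using i k by (intro member_le_sum) auto
    then show "norm (of_nat (k choose i) * ((a - z) / of_real d) ^ (k - i) * sobolev_op n u (test_fun N a i) z)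
        \<le> of_nat (k choose i) * (norm (a - z) / d) ^ (k - i) * s"
      using d by (simp add: norm_mult norm_power norm_divide mult_left_mono)
  qed
  also have "\<dots> = (\<Sum>i\<le>k. of_nat (k choose i) * 1 ^ i * (norm (a - z) / d) ^ (k - i)) * s"
    by (simp add: sum_distrib_right)
  \<comment> \<open>The absolute values of the recombination coefficients again sum to a binomial
    power, and \<open>norm (a - z) \<le> 4 * d\<close> near \<open>a\<close> yields
    \<open>5 ^ k\<close>.\<close>
  also have "\<dots> = (1 + norm (a - z) / d) ^ k * s"
    by (simp add: binomial_ring)
  also have "\<dots> \<le> 5 ^ k * s"
    using az d s by (intro mult_right_mono power_mono) auto
  finally have X: "norm X \<le> 5 ^ k * s" .
  have Y: "norm Y \<le> (\<Sum>j\<in>{k<..n}. C j * (of_nat (j choose k) * fact k) * (fact (j - k) * 2 ^ N * 2 ^ (j - k)) * s)"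
    unfolding Y_def
  proof (rule sum_norm_le)
    fix j assume j: "j \<in> {k<..n}"
    have "norm (u j z * (of_nat (j choose k) * fact k / of_real d ^ k * kderiv (j - k) (test_fun N a 0) z)) =
        norm (u j z) * ((of_nat (j choose k) * fact k) / d ^ k * norm (kderiv (j - k) (test_fun N a 0) z))"
      using d by (simp add: norm_mult norm_divide norm_power)
    also have "\<dots> \<le> (C j * d ^ j * s) *
        ((of_nat (j choose k) * fact k) / d ^ k * (fact (j - k) * 2 ^ N * 2 ^ (j - k) / d ^ (j - k)))"
      using j d C[of j] s IH[of j, folded s_def d_def] norm_kderiv_test_fun_0_le[OF a z, of "j - k" N, folded d_def]
      by (intro mult_mono) auto
    also have "\<dots> = C j * (of_nat (j choose k) * fact k) * (fact (j - k) * 2 ^ N * 2 ^ (j - k)) * s * (d ^ j / (d ^ k * d ^ (j - k)))"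
      by simp
    \<comment> \<open>The gain \<open>d ^ j\<close> for \<open>u j\<close> exactly offsets the two
      losses, so the constant does not depend on \<open>a\<close>.\<close>
    also have "d ^ j / (d ^ k * d ^ (j - k)) = 1"
      using d j by (simp flip: power_add)
    finally show "norm (u j z * (of_nat (j choose k) * fact k / of_real d ^ k * kderiv (j - k) (test_fun N a 0) z)) \<le>
        C j * (of_nat (j choose k) * fact k) * (fact (j - k) * 2 ^ N * 2 ^ (j - k)) * s" by simp
  qed
  have "1 / 4 ^ N \<le> norm (test_fun N a 0 z)"
    by (rule norm_test_fun_0_ge[OF a z near])
  then have "1 / d ^ k * (1 / 4 ^ N) * norm (u k z) \<le> fact k / d ^ k * norm (test_fun N a 0 z) * norm (u k z)"
    using d by (intro mult_mono mult_right_mono divide_right_mono) (auto simp: fact_ge_1)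
  also have "\<dots> = norm (fact k / of_real d ^ k * test_fun N a 0 z * u k z)"
    using d by (simp add: norm_mult norm_divide norm_power)
  also have "\<dots> = norm (X - Y)"
    unfolding X_def Y_def d_def by (subst sobolev_op_test_fun[OF a z k]) simp
  also have "\<dots> \<le> norm X + norm Y"
    by (rule norm_triangle_ineq4)
  also have "\<dots> \<le> 5 ^ k * s + (\<Sum>j\<in>{k<..n}. C j * (of_nat (j choose k) * fact k) * (fact (j - k) * 2 ^ N * 2 ^ (j - k)) * s)"
    using X Y by linarith
  also have "\<dots> = Q * s"
    by (simp only: distrib_right sum_distrib_right Q_def)
  finally have "4 ^ N * d ^ k * (1 / d ^ k * (1 / 4 ^ N) * norm (u k z)) \<le> 4 ^ N * d ^ k * (Q * s)"
    using d by (intro mult_left_mono) auto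
  then show ?thesis
    unfolding s_def[symmetric] d_def[symmetric] Q_def[symmetric] using d by (simp add: mult_ac)
qed

text \<open>The order of the quantifiers is the point: one constant serves all \<open>u\<close>,
  \<open>a\<close> and \<open>z\<close>. This is why constants for all higher indices are chosen
  before \<open>u\<close> is fixed in the induction step.\<close>

lemma norm_coeff_le:
  assumes "k \<le> n"
  shows "\<exists>C\<ge>0. \<forall>u a z. norm a < 1 \<longrightarrow> z \<in> disc \<longrightarrow> norm (1 - cnj a * z) \<le> 4 * (1 - norm a) \<longrightarrow>
     norm (u k z) \<le> C * (1 - norm a) ^ k * (\<Sum>i\<le>n. norm (sobolev_op n u (test_fun N a i) z))"
    (is "\<exists>C\<ge>0. ?P k C")
  using assms
proof (induction "n - k" arbitrary: k rule: less_induct)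
  case less
  have "\<forall>j\<in>{k<..n}. \<exists>C. C \<ge> 0 \<and> ?P j C"
  proof
    fix j assume "j \<in> {k<..n}"
    then show "\<exists>C. C \<ge> 0 \<and> ?P j C"
      using less.prems by (intro less.hyps) auto
  qed
  from bchoice[OF this] obtain C where C: "\<forall>j\<in>{k<..n}. C j \<ge> 0 \<and> ?P j (C j)" ..
  show ?case
  proof (intro exI conjI allI impI)
    show "0 \<le> 4 ^ N * (5 ^ k + (\<Sum>j\<in>{k<..n}. C j * (of_nat (j choose k) * fact k) * (fact (j - k) * 2 ^ N * 2 ^ (j - k))))"
      using C by (intro mult_nonneg_nonneg add_nonneg_nonneg sum_nonneg) auto
  next
    fix u a z
    assume a: "norm a < 1" "z \<in> disc" "norm (1 - cnj a * z) \<le> 4 * (1 - norm a)"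
    show "norm (u k z) \<le> 4 ^ N * (5 ^ k + (\<Sum>j\<in>{k<..n}. C j * (of_nat (j choose k) * fact k) * (fact (j - k) * 2 ^ N * 2 ^ (j - k)))) *
        (1 - norm a) ^ k * (\<Sum>i\<le>n. norm (sobolev_op n u (test_fun N a i) z))"
      using C by (intro norm_coeff_le_step[OF a less.prems]) (use a in auto)
  qed
qed

section \<open>Carleson conditions from local bounds\<close>

text \<open>Comparing the sum with its largest term treats \<open>q < 1\<close> and
  \<open>q \<ge> 1\<close> alike.\<close>

lemma sum_powr_le:
  fixes x :: "'a \<Rightarrow> real"
  assumes "finite A" "\<And>i. i \<in> A \<Longrightarrow> x i \<ge> 0" "q > 0"
  shows "(\<Sum>i\<in>A. x i) powr q \<le> real (card A) powr q * (\<Sum>i\<in>A. x i powr q)"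
proof (cases "A = {}")
  case False
  define M where "M = Max (x ` A)"
  have "M \<in> x ` A"
    unfolding M_def using assms(1) False by (intro Max_in) auto
  then obtain i where i: "i \<in> A" "M = x i" by auto
  have "(\<Sum>i\<in>A. x i) \<le> real (card A) * M"
    unfolding M_def using assms(1) by (intro sum_bounded_above) auto
  then have "(\<Sum>i\<in>A. x i) powr q \<le> (real (card A) * M) powr q"
    using assms by (intro powr_mono2 sum_nonneg) auto
  also have "\<dots> = real (card A) powr q * x i powr q"
    using i assms by (simp add: powr_mult)
  also have "\<dots> \<le> real (card A) powr q * (\<Sum>i\<in>A. x i powr q)"
    using i assms(1) by (intro mult_left_mono member_le_sum) auto
  finally show ?thesis .
qed simp

lemma measurable_holomorphic_disc:
  assumes "borel_measure_on_disc \<nu>" "f holomorphic_on disc"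
  shows "f \<in> borel_measurable \<nu>"
proof -
  have "f \<in> borel_measurable (restrict_space borel disc)"
    by (intro borel_measurable_continuous_on_restrict holomorphic_on_imp_continuous_on assms)
  then show ?thesis
    using assms(1) by (simp add: borel_measure_on_disc_def cong: measurable_cong_sets)
qed

lemma space_borel_measure_on_disc: "borel_measure_on_disc \<nu> \<Longrightarrow> space \<nu> = disc"
  unfolding borel_measure_on_disc_def by (drule sets_eq_imp_space_eq) (simp add: space_restrict_space)

lemma sets_borel_measure_on_disc:
  "borel_measure_on_disc \<nu> \<Longrightarrow> A \<in> sets borel \<Longrightarrow> A \<subseteq> disc \<Longrightarrow> A \<in> sets \<nu>"
  unfolding borel_measure_on_disc_def by (auto simp: sets_restrict_space)

lemma open_disc: "open disc"
  by (simp add: disc_def)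

lemma holomorphic_kderiv_disc: "f holomorphic_on disc \<Longrightarrow> kderiv k f holomorphic_on disc"
  by (rule holomorphic_higher_deriv[OF _ open_disc])

lemma nn_integral_bergman:
  assumes f: "f \<in> bergman_space p" and p: "p > 0"
  shows "(\<integral>\<^sup>+z. indicator disc z * ennreal (norm (f z) powr p) \<partial>lborel) = ennreal (pi * bergman_norm p f powr p)"
proof -
  define I where "I = (\<integral>\<^sup>+z. indicator disc z * ennreal (norm (f z) powr p) \<partial>lborel)"
  have fin: "I / ennreal pi < top"
    using f by (simp add: bergman_space_def bergman_pnorm_pow_def I_def)
  then have "I \<noteq> top"
    by (auto simp: ennreal_top_divide)
  then obtain r where r: "I = ennreal r" "r \<ge> 0"
    by (cases I) auto
  have "bergman_norm p f powr p = r / pi"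
    using p r by (simp add: bergman_norm_def bergman_pnorm_pow_def powr_powr divide_ennreal flip: I_def)
  then show ?thesis
    using r by (simp add: I_def)
qed

text \<open>The local estimate with exponent \<open>p\<close> is raised to the power
  \<open>q / p\<close>. To keep the result linear in the local integral, only one factor stays local
  and the remaining power is bounded by the full norm.\<close>

lemma kderiv_powr_le_bergman:
  fixes f :: "complex \<Rightarrow> complex" and k :: nat
  assumes p: "0 < p" and pq: "p \<le> q" and f: "f \<in> bergman_space p" and z: "z \<in> disc"
  defines "e \<equiv> (real k + 2 / p) * q" and "C0 \<equiv> fact k powr p * (2 powr p + 2 powr (2 / p))"
  shows "ennreal (norm (kderiv k f z) powr q) \<le>
     ennreal (8 powr e * (C0 * pi) powr ((q - p) / p) * C0 * bergman_norm p f powr (q - p)) *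
     (ennreal ((1 - norm z) powr - e) *
      (\<integral>\<^sup>+w. indicator (ball z ((1 - norm z) / 4)) w * ennreal (norm (f w) powr p) \<partial>lborel))"
proof -
  define d where "d = 1 - norm z"
  define X where "X = norm (kderiv k f z)"
  define s where "s = real k * p + 2"
  define B where "B = bergman_norm p f"
  have B: "B \<ge> 0" by (simp add: B_def bergman_norm_def)
  have C0: "C0 > 0"
    unfolding C0_def by (intro mult_pos_pos add_pos_pos) auto
  have d: "d > 0" using z by (simp add: d_def disc_def)
  have hol: "f holomorphic_on disc"
    using f by (simp add: bergman_space_def)
  have sub: "cball z (d / 4) \<subseteq> disc"
  proof
    fix w assume "w \<in> cball z (d / 4)"
    then have "norm w \<le> norm z + d / 4"
      using norm_triangle_sub[of w z] by (simp add: dist_norm norm_minus_commute)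
    also have "\<dots> < 1"
      using d by (simp add: d_def field_simps)
    finally show "w \<in> disc"
      by (simp add: disc_def)
  qed
  define J where "J = (\<integral>\<^sup>+w. indicator (ball z (d / 4)) w * ennreal (norm (f w) powr p) \<partial>lborel)"
  have "J \<le> (\<integral>\<^sup>+w. indicator disc w * ennreal (norm (f w) powr p) \<partial>lborel)"
    unfolding J_def using sub ball_subset_cball by (intro nn_integral_mono mult_right_mono indicator_leI) auto
  also have "\<dots> = ennreal (pi * B powr p)"
    unfolding B_def by (rule nn_integral_bergman[OF f p])
  finally have J_le: "J \<le> ennreal (pi * B powr p)" .
  then obtain j where j: "J = ennreal j" "j \<ge> 0"
    by (cases J) (auto simp: top_unique)
  have j_le: "j \<le> pi * B powr p"
    using J_le j by (subst (asm) j(1), subst (asm) ennreal_le_iff) auto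
  \<comment> \<open>The radius \<open>d / 8\<close> is doubled by the derivative estimate; the
    resulting ball of radius \<open>d / 4\<close> stays inside the disc.\<close>
  have "ennreal (X powr p * (d / 8) powr s) \<le> ennreal C0 * J"
    using kderiv_powr_bound[OF p hol open_disc, of z "d / 8" k] d sub
    by (simp add: C0_def J_def X_def s_def)
  then have "ennreal (X powr p * (d / 8) powr s) \<le> ennreal (C0 * j)"
    using C0 j by (simp add: ennreal_mult)
  then have Xj: "X powr p * (d / 8) powr s \<le> C0 * j"
    using C0 j by (subst (asm) ennreal_le_iff) auto
  have e: "s * (q / p) = e" "p * (q / p) = q"
    using p by (simp_all add: s_def e_def field_simps)
  have "X powr q * (d / 8) powr e = (X powr p * (d / 8) powr s) powr (q / p)"
    by (simp only: powr_mult powr_powr e)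
  \<comment> \<open>Here \<open>p \<le> q\<close> matters: the exponent \<open>(q - p) / p\<close>
    is nonnegative, so the split-off power is monotone.\<close>
  also have "\<dots> = (X powr p * (d / 8) powr s) powr ((q - p) / p) * (X powr p * (d / 8) powr s)"
  proof -
    have "q / p = (q - p) / p + 1"
      using p by (simp add: field_simps)
    then show ?thesis
      by (simp add: powr_add del: powr_mult)
  qed
  also have "\<dots> \<le> (C0 * pi * B powr p) powr ((q - p) / p) * (C0 * j)"
  proof -
    have "C0 * j \<le> C0 * (pi * B powr p)"
      using j_le C0 by (intro mult_left_mono) auto
    then have "X powr p * (d / 8) powr s \<le> C0 * pi * B powr p"
      using Xj by (simp add: mult.assoc)
    then show ?thesis
      using p pq by (intro mult_mono[OF powr_mono2 Xj]) auto
  qed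
  also have "\<dots> = (C0 * pi) powr ((q - p) / p) * C0 * B powr (q - p) * j"
    using p C0 B by (simp add: powr_mult powr_powr)
  finally have "8 powr e * d powr (- e) * (X powr q * (d / 8) powr e) \<le>
      8 powr e * d powr (- e) * ((C0 * pi) powr ((q - p) / p) * C0 * B powr (q - p) * j)"
    by (intro mult_left_mono) auto
  also have "8 powr e * d powr (- e) * (X powr q * (d / 8) powr e) = X powr q"
    using d by (simp add: powr_divide powr_minus)
  finally have "ennreal (X powr q) \<le>
      ennreal ((8 powr e * (C0 * pi) powr ((q - p) / p) * C0 * B powr (q - p)) * (d powr (- e) * j))"
    by (intro ennreal_leI) (simp add: mult_ac)
  also have "\<dots> = ennreal (8 powr e * (C0 * pi) powr ((q - p) / p) * C0 * B powr (q - p)) * (ennreal (d powr (- e)) * J)"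
    using C0 j by (simp add: ennreal_mult)
  finally show ?thesis
    by (simp add: X_def B_def J_def d_def)
qed

text \<open>The inner integral after Tonelli's theorem. If \<open>z\<close> is within a quarter of
  its distance to the unit circle from \<open>w\<close>, then the two distances to the circle are
  comparable and \<open>z\<close> lies in the ball around \<open>w\<close>; so a condition centred
  at \<open>z\<close> becomes one centred at \<open>w\<close>.\<close>

lemma nn_integral_near_le:
  assumes nu: "borel_measure_on_disc \<nu>" and w: "w \<in> disc" and e: "e \<ge> 0" and \<epsilon>: "\<epsilon> \<ge> 0"
    and loc: "emeasure \<nu> (ball w ((1 - norm w) / 2)) \<le> ennreal (\<epsilon> * (1 - norm w) powr e)"
  shows "(\<integral>\<^sup>+z. (if dist z w < (1 - norm z) / 4 then ennreal ((1 - norm z) powr - e) else 0) \<partial>\<nu>)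
     \<le> ennreal (2 powr e * \<epsilon>)"
proof -
  define d where "d = 1 - norm w"
  have d: "d > 0" using w by (simp add: d_def disc_def)
  have sub: "ball w (d / 2) \<subseteq> disc"
  proof
    fix x assume "x \<in> ball w (d / 2)"
    then have "norm x < norm w + d / 2"
      using norm_triangle_sub[of x w] by (simp add: dist_norm norm_minus_commute)
    also have "\<dots> < 1"
      using d by (simp add: d_def field_simps)
    finally show "x \<in> disc"
      by (simp add: disc_def)
  qed
  have "(\<integral>\<^sup>+z. (if dist z w < (1 - norm z) / 4 then ennreal ((1 - norm z) powr - e) else 0) \<partial>\<nu>)
     \<le> (\<integral>\<^sup>+z. ennreal (2 powr e * d powr - e) * indicator (ball w (d / 2)) z \<partial>\<nu>)"
  proof (rule nn_integral_mono)
    fix z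
    show "(if dist z w < (1 - norm z) / 4 then ennreal ((1 - norm z) powr - e) else 0)
        \<le> ennreal (2 powr e * d powr - e) * indicator (ball w (d / 2)) z"
    proof (cases "dist z w < (1 - norm z) / 4")
      case True
      have "\<bar>norm z - norm w\<bar> \<le> dist z w"
        unfolding dist_norm by (rule norm_triangle_ineq3)
      then have 1: "d / 2 \<le> 1 - norm z" and 2: "dist z w < d / 2"
        using True d unfolding d_def by auto
      have "(1 - norm z) powr - e \<le> (d / 2) powr - e"
        using 1 d e by (intro powr_mono2') auto
      also have "\<dots> = 2 powr e * d powr - e"
        using d by (simp add: powr_divide powr_minus_divide)
      finally show ?thesis
        using True 2 by (simp add: dist_commute ennreal_leI)
    qed simp
  qed
  also have "\<dots> = ennreal (2 powr e * d powr - e) * emeasure \<nu> (ball w (d / 2))"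
    by (rule nn_integral_cmult_indicator) (rule sets_borel_measure_on_disc[OF nu _ sub], simp)
  also have "\<dots> \<le> ennreal (2 powr e * d powr - e) * ennreal (\<epsilon> * d powr e)"
    using loc unfolding d_def by (intro mult_left_mono) auto
  also have "\<dots> = ennreal (2 powr e * \<epsilon>)"
    using d \<epsilon> by (simp add: powr_minus flip: ennreal_mult)
  finally show ?thesis .
qed

text \<open>The constant precedes the measure and \<open>\<epsilon>\<close>, and the bound is linear
  in \<open>\<epsilon>\<close>. The vanishing case needs both, since it applies the bound to a
  truncated measure with small \<open>\<epsilon>\<close>.\<close>

lemma carleson_bound_of_local:
  fixes k :: nat
  assumes p: "0 < p" and pq: "p \<le> q"
  defines "e \<equiv> (real k + 2 / p) * q"
  shows "\<exists>C>0. \<forall>\<nu> \<epsilon> f. borel_measure_on_disc \<nu> \<longrightarrow> emeasure \<nu> disc < top \<longrightarrow> \<epsilon> \<ge> 0 \<longrightarrow>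
     (\<forall>w\<in>disc. emeasure \<nu> (ball w ((1 - norm w) / 2)) \<le> ennreal (\<epsilon> * (1 - norm w) powr e)) \<longrightarrow>
     f \<in> bergman_space p \<longrightarrow>
     (\<integral>\<^sup>+z. ennreal (norm (kderiv k f z) powr q) \<partial>\<nu>) \<le> ennreal (C * \<epsilon> * bergman_norm p f powr q)"
proof -
  define C0 where "C0 = fact k powr p * (2 powr p + 2 powr (2 / p))"
  have C0: "C0 > 0"
    unfolding C0_def by (intro mult_pos_pos add_pos_pos) auto
  define K where "K = 8 powr e * (C0 * pi) powr ((q - p) / p) * C0"
  have K: "K > 0"
    using C0 by (simp add: K_def)
  have e: "e \<ge> 0"
    using p pq by (simp add: e_def)
  show ?thesis
  proof (intro exI[of _ "K * 2 powr e * pi"] conjI allI impI)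
    show "K * 2 powr e * pi > 0"
      using K by simp
    fix \<nu> :: "complex measure" and \<epsilon> :: real and f :: "complex \<Rightarrow> complex"
    assume nu: "borel_measure_on_disc \<nu>" and fin: "emeasure \<nu> disc < top" and \<epsilon>: "\<epsilon> \<ge> 0"
      and loc: "\<forall>w\<in>disc. emeasure \<nu> (ball w ((1 - norm w) / 2)) \<le> ennreal (\<epsilon> * (1 - norm w) powr e)"
      and f: "f \<in> bergman_space p"
    define B where "B = bergman_norm p f"
    have B: "B \<ge> 0" by (simp add: B_def bergman_norm_def)
    define g where "g w = indicator disc w * ennreal (norm (f w) powr p)" for w
    have hol: "f holomorphic_on disc"
      using f by (simp add: bergman_space_def)
    have [measurable]: "g \<in> borel_measurable borel"
      unfolding g_def[abs_def] using holomorphic_on_imp_continuous_on[OF hol] open_disc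
      by (intro borel_measurable_indicator_holomorphic) auto
    \<comment> \<open>Tonelli's theorem needs a sigma-finite measure, which
      \<open>borel_measure_on_disc\<close> alone does not provide.\<close>
    interpret finite_measure \<nu>
      using fin by (intro finite_measureI) (simp add: space_borel_measure_on_disc[OF nu] less_top)
    interpret pair_sigma_finite \<nu> lborel ..
    have id: "(\<lambda>z. z) \<in> borel_measurable \<nu>"
      by (rule measurable_holomorphic_disc[OF nu]) (intro holomorphic_intros)
    then have [measurable]: "fst \<in> borel_measurable (\<nu> \<Otimes>\<^sub>M lborel)"
      by (rule measurable_compose[OF measurable_fst])
    define h where "h z w = (if dist z w < (1 - norm z) / 4 then ennreal ((1 - norm z) powr - e) * g w else 0)" for z w
    have h_meas: "case_prod h \<in> borel_measurable (\<nu> \<Otimes>\<^sub>M lborel)"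
      unfolding h_def split_beta' by measurable
    have "(\<integral>\<^sup>+z. ennreal (norm (kderiv k f z) powr q) \<partial>\<nu>) \<le>
        (\<integral>\<^sup>+z. ennreal (K * B powr (q - p)) * (\<integral>\<^sup>+w. h z w \<partial>lborel) \<partial>\<nu>)"
    proof (rule nn_integral_mono)
      fix z assume "z \<in> space \<nu>"
      then have z: "z \<in> disc"
        using space_borel_measure_on_disc[OF nu] by simp
      have sub: "w \<in> disc" if "dist z w < (1 - norm z) / 4" for w
        using that norm_triangle_sub[of w z] z by (auto simp: dist_norm norm_minus_commute disc_def)
      have "ennreal (norm (kderiv k f z) powr q) \<le>
         ennreal (K * B powr (q - p)) * (ennreal ((1 - norm z) powr - e) *
          (\<integral>\<^sup>+w. indicator (ball z ((1 - norm z) / 4)) w * ennreal (norm (f w) powr p) \<partial>lborel))"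
        using kderiv_powr_le_bergman[OF p pq f z, of k] by (simp add: K_def B_def C0_def e_def)
      also have "(\<integral>\<^sup>+w. indicator (ball z ((1 - norm z) / 4)) w * ennreal (norm (f w) powr p) \<partial>lborel) =
          (\<integral>\<^sup>+w. (if dist z w < (1 - norm z) / 4 then g w else 0) \<partial>lborel)"
        using sub by (intro nn_integral_cong) (auto simp: g_def indicator_def)
      also have "ennreal ((1 - norm z) powr - e) * \<dots> = (\<integral>\<^sup>+w. h z w \<partial>lborel)"
        unfolding h_def by (subst nn_integral_cmult[symmetric]) (auto intro!: nn_integral_cong)
      finally show "ennreal (norm (kderiv k f z) powr q) \<le>
          ennreal (K * B powr (q - p)) * (\<integral>\<^sup>+w. h z w \<partial>lborel)" .
    qed
    also have "\<dots> = ennreal (K * B powr (q - p)) * (\<integral>\<^sup>+z. \<integral>\<^sup>+w. h z w \<partial>lborel \<partial>\<nu>)"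
      using lborel.borel_measurable_nn_integral_fst[OF h_meas] by (intro nn_integral_cmult) simp
    \<comment> \<open>After the exchange, \<open>w\<close> is fixed in the inner integral, where the
      local mass bound applies and leaves \<open>norm (f w) powr p\<close> to be integrated over the
      disc.\<close>
    also have "(\<integral>\<^sup>+z. \<integral>\<^sup>+w. h z w \<partial>lborel \<partial>\<nu>) = (\<integral>\<^sup>+w. \<integral>\<^sup>+z. h z w \<partial>\<nu> \<partial>lborel)"
      by (rule Fubini'[OF h_meas, symmetric])
    also have "\<dots> \<le> (\<integral>\<^sup>+w. ennreal (2 powr e * \<epsilon>) * g w \<partial>lborel)"
    proof (rule nn_integral_mono)
      fix w
      show "(\<integral>\<^sup>+z. h z w \<partial>\<nu>) \<le> ennreal (2 powr e * \<epsilon>) * g w"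
      proof (cases "w \<in> disc")
        case True
        have "(\<integral>\<^sup>+z. h z w \<partial>\<nu>) = (\<integral>\<^sup>+z. (if dist z w < (1 - norm z) / 4 then ennreal ((1 - norm z) powr - e) else 0) * g w \<partial>\<nu>)"
          by (intro nn_integral_cong) (simp add: h_def)
        also have "\<dots> = (\<integral>\<^sup>+z. (if dist z w < (1 - norm z) / 4 then ennreal ((1 - norm z) powr - e) else 0) \<partial>\<nu>) * g w"
          by (rule nn_integral_multc, rule measurable_compose[OF id]) measurable
        also have "\<dots> \<le> ennreal (2 powr e * \<epsilon>) * g w"
          using loc True by (intro mult_right_mono nn_integral_near_le[OF nu True e \<epsilon>]) auto
        finally show ?thesis .
      next
        case False
        then have "h z w = 0" for z
          by (simp add: h_def g_def)
        then show ?thesis by simp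
      qed
    qed
    also have "\<dots> = ennreal (2 powr e * \<epsilon>) * ennreal (pi * B powr p)"
      using nn_integral_bergman[OF f p] by (simp add: nn_integral_cmult g_def[abs_def, symmetric] B_def)
    finally have "(\<integral>\<^sup>+z. ennreal (norm (kderiv k f z) powr q) \<partial>\<nu>) \<le>
        ennreal (K * B powr (q - p)) * (ennreal (2 powr e * \<epsilon>) * ennreal (pi * B powr p))"
      by (simp add: mult_left_mono)
    also have "\<dots> = ennreal (K * 2 powr e * pi * \<epsilon> * (B powr (q - p) * B powr p))"
      using K \<epsilon> by (simp add: mult_ac flip: ennreal_mult)
    also have "B powr (q - p) * B powr p = B powr q"
      by (simp flip: powr_add)
    finally show "(\<integral>\<^sup>+z. ennreal (norm (kderiv k f z) powr q) \<partial>\<nu>) \<le>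
        ennreal (K * 2 powr e * pi * \<epsilon> * bergman_norm p f powr q)"
      by (simp add: B_def)
  qed
qed

section \<open>Sobolev Carleson measures\<close>

lemma holomorphic_sobolev_op:
  assumes "\<And>k. k \<le> n \<Longrightarrow> u k holomorphic_on disc" "f holomorphic_on disc"
  shows "sobolev_op n u f holomorphic_on disc"
  unfolding sobolev_op_def[abs_def]
  by (intro holomorphic_on_sum holomorphic_on_mult holomorphic_kderiv_disc assms) auto

lemma nn_integral_weighted_measure:
  assumes mu: "borel_measure_on_disc \<mu>" and g: "g holomorphic_on disc" and f: "f holomorphic_on disc"
  shows "(\<integral>\<^sup>+z. ennreal (norm (f z) powr q) \<partial>weighted_measure \<mu> g q) =
    (\<integral>\<^sup>+z. ennreal (norm (g z * f z) powr q) \<partial>\<mu>)"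
proof -
  note [measurable] = measurable_holomorphic_disc[OF mu g] measurable_holomorphic_disc[OF mu f]
  show ?thesis
    unfolding weighted_measure_def
    by (subst nn_integral_density) (auto simp: norm_mult powr_mult ennreal_mult)
qed

lemma nn_integral_sobolev_op_le:
  assumes mu: "borel_measure_on_disc \<mu>" and u: "\<And>k. k \<le> n \<Longrightarrow> u k holomorphic_on disc"
    and f: "f holomorphic_on disc" and q: "q > 0"
  shows "(\<integral>\<^sup>+z. ennreal (norm (sobolev_op n u f z) powr q) \<partial>\<mu>) \<le>
     ennreal (real (Suc n) powr q) * (\<Sum>k\<le>n. \<integral>\<^sup>+z. ennreal (norm (kderiv k f z) powr q) \<partial>weighted_measure \<mu> (u k) q)"
proof -
  have [measurable]: "u k \<in> borel_measurable \<mu>" if "k \<le> n" for k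
    by (rule measurable_holomorphic_disc[OF mu u[OF that]])
  have [measurable]: "kderiv k f \<in> borel_measurable \<mu>" for k
    by (rule measurable_holomorphic_disc[OF mu holomorphic_kderiv_disc[OF f]])
  have meas: "(\<lambda>z. ennreal (norm (u k z * kderiv k f z) powr q)) \<in> borel_measurable \<mu>" if "k \<le> n" for k
    using that by measurable
  have "(\<integral>\<^sup>+z. ennreal (norm (sobolev_op n u f z) powr q) \<partial>\<mu>) \<le>
     (\<integral>\<^sup>+z. ennreal (real (Suc n) powr q) * (\<Sum>k\<le>n. ennreal (norm (u k z * kderiv k f z) powr q)) \<partial>\<mu>)"
  proof (rule nn_integral_mono)
    fix z
    have "norm (sobolev_op n u f z) powr q \<le> (\<Sum>k\<le>n. norm (u k z * kderiv k f z)) powr q"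
      unfolding sobolev_op_def using q by (intro powr_mono2 norm_sum) auto
    also have "\<dots> \<le> real (card {..n}) powr q * (\<Sum>k\<le>n. norm (u k z * kderiv k f z) powr q)"
      using q by (intro sum_powr_le) auto
    finally have "ennreal (norm (sobolev_op n u f z) powr q) \<le>
        ennreal (real (Suc n) powr q * (\<Sum>k\<le>n. norm (u k z * kderiv k f z) powr q))"
      by (intro ennreal_leI) simp
    then show "ennreal (norm (sobolev_op n u f z) powr q) \<le>
        ennreal (real (Suc n) powr q) * (\<Sum>k\<le>n. ennreal (norm (u k z * kderiv k f z) powr q))"
      by (simp add: ennreal_mult sum_nonneg)
  qed
  also have "\<dots> = ennreal (real (Suc n) powr q) * (\<Sum>k\<le>n. \<integral>\<^sup>+z. ennreal (norm (u k z * kderiv k f z) powr q) \<partial>\<mu>)"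
  proof -
    have "(\<integral>\<^sup>+z. (\<Sum>k\<le>n. ennreal (norm (u k z * kderiv k f z) powr q)) \<partial>\<mu>) =
        (\<Sum>k\<le>n. \<integral>\<^sup>+z. ennreal (norm (u k z * kderiv k f z) powr q) \<partial>\<mu>)"
      by (intro nn_integral_sum meas) auto
    moreover have "(\<lambda>z. \<Sum>k\<le>n. ennreal (norm (u k z * kderiv k f z) powr q)) \<in> borel_measurable \<mu>"
      by (intro borel_measurable_sum meas) auto
    ultimately show ?thesis
      by (simp only: nn_integral_cmult)
  qed
  also have "\<dots> = ennreal (real (Suc n) powr q) * (\<Sum>k\<le>n. \<integral>\<^sup>+z. ennreal (norm (kderiv k f z) powr q) \<partial>weighted_measure \<mu> (u k) q)"
    by (intro arg_cong2[where f = "(*)"] sum.cong refl nn_integral_weighted_measure[symmetric] mu u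
        holomorphic_kderiv_disc f) auto
  finally show ?thesis .
qed

section \<open>Carleson regions and the mass of the weighted measures\<close>

text \<open>A region of Carleson box type. The factor 4 is large enough for it to contain the ball
  around \<open>a\<close> of half the distance to the unit circle, and to be the whole disc for
  \<open>a = 0\<close>.\<close>

definition near :: "complex \<Rightarrow> complex set" where
  "near a = {z \<in> disc. norm (1 - cnj a * z) \<le> 4 * (1 - norm a)}"

lemma near_subset_disc: "near a \<subseteq> disc"
  by (auto simp: near_def)

lemma near_0: "near 0 = disc"
  by (auto simp: near_def)

lemma sets_borel_near: "near a \<in> sets borel"
proof -
  have "near a = disc \<inter> {z. norm (1 - cnj a * z) \<le> 4 * (1 - norm a)}"
    by (auto simp: near_def)
  also have "\<dots> \<in> sets borel"
    using open_disc by (intro sets.Int borel_open borel_closed closed_Collect_le continuous_intros)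
  finally show ?thesis .
qed

lemma ball_subset_near:
  assumes "norm a < 1"
  shows "ball a ((1 - norm a) / 2) \<subseteq> near a"
proof
  fix z assume z: "z \<in> ball a ((1 - norm a) / 2)"
  have "norm z < norm a + (1 - norm a) / 2"
    using z norm_triangle_sub[of z a] by (simp add: dist_norm norm_minus_commute field_simps)
  then have "norm z < 1"
    using assms by (simp add: field_simps)
  \<comment> \<open>Expanding around \<open>z = a\<close> bounds the modulus by
    \<open>2 * d + d / 2\<close> with \<open>d = 1 - norm a\<close>, below
    \<open>4 * d\<close>.\<close>
  have "1 - cnj a * z = of_real (1 - (norm a)\<^sup>2) - cnj a * (z - a)"
    using complex_norm_square[of a] by (simp add: algebra_simps)
  then have "norm (1 - cnj a * z) \<le> norm (complex_of_real (1 - (norm a)\<^sup>2)) + norm (cnj a * (z - a))"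
    by (simp only: norm_triangle_ineq4)
  also have "\<dots> = (1 - (norm a)\<^sup>2) + norm a * norm (z - a)"
    using assms by (simp add: norm_mult power_le_one not_less abs_if flip: of_real_power of_real_diff)
  also have "\<dots> \<le> (1 - norm a) * (1 + norm a) + 1 * ((1 - norm a) / 2)"
    using z assms by (intro add_mono mult_mono) (auto simp: dist_norm norm_minus_commute power2_eq_square algebra_simps)
  also have "\<dots> \<le> (1 - norm a) * 2 + 1 * ((1 - norm a) / 2)"
    using assms by (intro add_mono mult_left_mono) auto
  also have "\<dots> \<le> 4 * (1 - norm a)"
    using assms by (simp add: field_simps)
  finally show "z \<in> near a"
    unfolding near_def using \<open>norm z < 1\<close> by (simp add: disc_def)
qed

lemma emeasure_weighted_measure_le:
  assumes k: "k \<le> n" and q: "q > 0"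
  shows "\<exists>C>0. \<forall>\<mu> u a. borel_measure_on_disc \<mu> \<longrightarrow> (\<forall>k\<le>n. u k holomorphic_on disc) \<longrightarrow> norm a < 1 \<longrightarrow>
     emeasure (weighted_measure \<mu> (u k) q) (near a) \<le>
     ennreal (C * (1 - norm a) powr (real k * q)) *
       (\<Sum>i\<le>n. \<integral>\<^sup>+z. ennreal (norm (sobolev_op n u (test_fun N a i) z) powr q) \<partial>\<mu>)"
proof -
  obtain C where C: "C \<ge> 0" and le: "\<And>u a z. norm a < 1 \<Longrightarrow> z \<in> disc \<Longrightarrow> norm (1 - cnj a * z) \<le> 4 * (1 - norm a) \<Longrightarrow>
     norm (u k z) \<le> C * (1 - norm a) ^ k * (\<Sum>i\<le>n. norm (sobolev_op n u (test_fun N a i) z))"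
    using norm_coeff_le[OF k, of N] by blast
  \<comment> \<open>Adding 1 makes the constant positive even if \<open>C\<close> is 0.\<close>
  define C' where "C' = (C + 1) powr q * real (Suc n) powr q"
  show ?thesis
  proof (intro exI[of _ C'] conjI allI impI)
    show "C' > 0" using C by (simp add: C'_def)
    fix \<mu> :: "complex measure" and u :: "nat \<Rightarrow> complex \<Rightarrow> complex" and a :: complex
    assume mu: "borel_measure_on_disc \<mu>" and u: "\<forall>k\<le>n. u k holomorphic_on disc" and a: "norm a < 1"
    define d where "d = 1 - norm a"
    have d: "d > 0" using a by (simp add: d_def)
    have [measurable]: "near a \<in> sets \<mu>"
      by (rule sets_borel_measure_on_disc[OF mu sets_borel_near near_subset_disc])
    have [measurable]: "u k \<in> borel_measurable \<mu>"
      using u k by (intro measurable_holomorphic_disc[OF mu]) auto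
    have meas: "sobolev_op n u (test_fun N a i) \<in> borel_measurable \<mu>" for i
      using u by (intro measurable_holomorphic_disc[OF mu] holomorphic_sobolev_op holomorphic_test_fun[OF a]) auto
    have meas': "(\<lambda>z. ennreal (norm (sobolev_op n u (test_fun N a i) z) powr q)) \<in> borel_measurable \<mu>" for i
      using meas[of i] by measurable
    have "emeasure (weighted_measure \<mu> (u k) q) (near a) = (\<integral>\<^sup>+z. ennreal (norm (u k z) powr q) * indicator (near a) z \<partial>\<mu>)"
      unfolding weighted_measure_def by (rule emeasure_density) measurable
    also have "\<dots> \<le> (\<integral>\<^sup>+z. ennreal (C' * d powr (real k * q)) *
        (\<Sum>i\<le>n. ennreal (norm (sobolev_op n u (test_fun N a i) z) powr q)) \<partial>\<mu>)"
    proof (rule nn_integral_mono)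
      fix z
      show "ennreal (norm (u k z) powr q) * indicator (near a) z \<le> ennreal (C' * d powr (real k * q)) *
        (\<Sum>i\<le>n. ennreal (norm (sobolev_op n u (test_fun N a i) z) powr q))"
      proof (cases "z \<in> near a")
        case True
        define S where "S = (\<Sum>i\<le>n. norm (sobolev_op n u (test_fun N a i) z))"
        have S: "S \<ge> 0" by (simp add: S_def sum_nonneg)
        have "norm (u k z) \<le> C * d ^ k * S"
          unfolding d_def S_def using True by (intro le[OF a]) (auto simp: near_def)
        also have "\<dots> \<le> (C + 1) * d ^ k * S"
          using C d S by (intro mult_right_mono) auto
        finally have "norm (u k z) powr q \<le> ((C + 1) * d ^ k * S) powr q"
          using q by (intro powr_mono2) auto
        also have "\<dots> = (C + 1) powr q * d powr (real k * q) * S powr q"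
          using d by (simp add: powr_mult powr_powr flip: powr_realpow)
        also have "\<dots> \<le> (C + 1) powr q * d powr (real k * q) *
            (real (card {..n}) powr q * (\<Sum>i\<le>n. norm (sobolev_op n u (test_fun N a i) z) powr q))"
          unfolding S_def using q by (intro mult_left_mono sum_powr_le) auto
        finally have "norm (u k z) powr q \<le>
            C' * d powr (real k * q) * (\<Sum>i\<le>n. norm (sobolev_op n u (test_fun N a i) z) powr q)"
          by (simp add: C'_def mult_ac)
        then have "ennreal (norm (u k z) powr q) \<le>
            ennreal (C' * d powr (real k * q) * (\<Sum>i\<le>n. norm (sobolev_op n u (test_fun N a i) z) powr q))"
          by (rule ennreal_leI)
        then show ?thesis
          using True by (simp add: C'_def ennreal_mult sum_nonneg)
      qed simp
    qed
    also have "\<dots> = ennreal (C' * d powr (real k * q)) *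
        (\<Sum>i\<le>n. \<integral>\<^sup>+z. ennreal (norm (sobolev_op n u (test_fun N a i) z) powr q) \<partial>\<mu>)"
    proof -
      have "(\<integral>\<^sup>+z. (\<Sum>i\<le>n. ennreal (norm (sobolev_op n u (test_fun N a i) z) powr q)) \<partial>\<mu>) =
          (\<Sum>i\<le>n. \<integral>\<^sup>+z. ennreal (norm (sobolev_op n u (test_fun N a i) z) powr q) \<partial>\<mu>)"
        by (intro nn_integral_sum meas')
      moreover have "(\<lambda>z. \<Sum>i\<le>n. ennreal (norm (sobolev_op n u (test_fun N a i) z) powr q)) \<in> borel_measurable \<mu>"
        by (intro borel_measurable_sum meas')
      ultimately show ?thesis
        by (simp only: nn_integral_cmult)
    qed
    finally show "emeasure (weighted_measure \<mu> (u k) q) (near a) \<le>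
       ennreal (C' * (1 - norm a) powr (real k * q)) *
       (\<Sum>i\<le>n. \<integral>\<^sup>+z. ennreal (norm (sobolev_op n u (test_fun N a i) z) powr q) \<partial>\<mu>)"
      by (simp add: d_def)
  qed
qed

lemma borel_measure_on_disc_density:
  "borel_measure_on_disc \<mu> \<Longrightarrow> borel_measure_on_disc (density \<mu> g)"
  by (simp add: borel_measure_on_disc_def)

lemma borel_measure_on_disc_weighted_measure:
  "borel_measure_on_disc \<mu> \<Longrightarrow> borel_measure_on_disc (weighted_measure \<mu> g q)"
  by (simp add: weighted_measure_def borel_measure_on_disc_density)

lemma test_fun_bergman_norm:
  assumes a: "norm a < 1" and i: "i \<le> n" and p: "p > 0" and m: "real m * p \<ge> 4"
  shows "bergman_norm p (test_fun (n + m) a i) \<le> 86 powr (1 / p) * (1 - norm a) powr (2 / p)"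
proof -
  have "enn2real (bergman_pnorm_pow p (test_fun (n + m) a i)) \<le> 86 * (1 - norm a)\<^sup>2"
    using enn2real_mono[OF test_fun_bergman(1)[OF a i p m]] by simp
  then have "bergman_norm p (test_fun (n + m) a i) \<le> (86 * (1 - norm a)\<^sup>2) powr (1 / p)"
    unfolding bergman_norm_def using p by (intro powr_mono2) auto
  also have "\<dots> = 86 powr (1 / p) * (1 - norm a) powr (2 / p)"
    using a by (simp add: powr_mult powr_powr flip: powr_numeral)
  finally show ?thesis .
qed

lemma carleson_of_sobolev_carleson:
  assumes p: "0 < p" and pq: "p \<le> q" and u: "\<And>k. k \<le> n \<Longrightarrow> u k holomorphic_on disc"
    and mu: "borel_measure_on_disc \<mu>" and sc: "sobolev_carleson n u p q \<mu>" and k: "k \<le> n"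
  shows "carleson k p q (weighted_measure \<mu> (u k) q)"
proof -
  define e where "e = (real k + 2 / p) * q"
  define \<nu> where "\<nu> = weighted_measure \<mu> (u k) q"
  have q: "q > 0" using p pq by simp
  have nu: "borel_measure_on_disc \<nu>"
    unfolding \<nu>_def by (rule borel_measure_on_disc_weighted_measure[OF mu])
  obtain m :: nat where "4 / p \<le> real m"
    using real_arch_simple by blast
  then have m: "real m * p \<ge> 4"
    using p by (simp add: field_simps)
  obtain C1 where C1: "C1 > 0" and bd: "\<And>f. f \<in> bergman_space p \<Longrightarrow>
      (\<integral>\<^sup>+z. ennreal (norm (sobolev_op n u f z) powr q) \<partial>\<mu>) \<le> ennreal (C1 * bergman_norm p f powr q)"
    using sc unfolding sobolev_carleson_def by blast
  obtain C2 where C2: "C2 > 0" and meas_le: "\<And>a. norm a < 1 \<Longrightarrow>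
     emeasure \<nu> (near a) \<le>
     ennreal (C2 * (1 - norm a) powr (real k * q)) *
       (\<Sum>i\<le>n. \<integral>\<^sup>+z. ennreal (norm (sobolev_op n u (test_fun (n + m) a i) z) powr q) \<partial>\<mu>)"
    using emeasure_weighted_measure_le[OF k q, of "n + m"] mu u unfolding \<nu>_def by blast
  define \<epsilon> where "\<epsilon> = C2 * (real (Suc n) * (C1 * (86 powr (1 / p)) powr q))"
  have \<epsilon>: "\<epsilon> > 0" using C1 C2 by (simp add: \<epsilon>_def)
  have loc: "emeasure \<nu> (near a) \<le> ennreal (\<epsilon> * (1 - norm a) powr e)"
    if a: "norm a < 1" for a
  proof -
    have "(\<Sum>i\<le>n. \<integral>\<^sup>+z. ennreal (norm (sobolev_op n u (test_fun (n + m) a i) z) powr q) \<partial>\<mu>) \<le>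
       (\<Sum>i\<le>n. ennreal (C1 * (86 powr (1 / p) * (1 - norm a) powr (2 / p)) powr q))"
    proof (rule sum_mono)
      fix i assume "i \<in> {..n}"
      then have i: "i \<le> n" by simp
      have "(\<integral>\<^sup>+z. ennreal (norm (sobolev_op n u (test_fun (n + m) a i) z) powr q) \<partial>\<mu>) \<le>
        ennreal (C1 * bergman_norm p (test_fun (n + m) a i) powr q)"
        by (rule bd[OF test_fun_bergman(2)[OF a i p m]])
      also have "\<dots> \<le> ennreal (C1 * (86 powr (1 / p) * (1 - norm a) powr (2 / p)) powr q)"
        using C1 q test_fun_bergman_norm[OF a i p m]
        by (intro ennreal_leI mult_left_mono powr_mono2) (auto simp: bergman_norm_def)
      finally show "(\<integral>\<^sup>+z. ennreal (norm (sobolev_op n u (test_fun (n + m) a i) z) powr q) \<partial>\<mu>) \<le>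
         ennreal (C1 * (86 powr (1 / p) * (1 - norm a) powr (2 / p)) powr q)" .
    qed
    also have "\<dots> = ennreal (\<Sum>i\<le>n. C1 * (86 powr (1 / p) * (1 - norm a) powr (2 / p)) powr q)"
      using C1 by (intro sum_ennreal) auto
    also have "(\<Sum>i\<le>n. C1 * (86 powr (1 / p) * (1 - norm a) powr (2 / p)) powr q) =
       real (Suc n) * (C1 * (86 powr (1 / p)) powr q) * (1 - norm a) powr (2 / p * q)"
      using a by (simp add: powr_mult powr_powr)
    finally have "emeasure \<nu> (near a) \<le>
       ennreal (C2 * (1 - norm a) powr (real k * q)) *
       ennreal (real (Suc n) * (C1 * (86 powr (1 / p)) powr q) * (1 - norm a) powr (2 / p * q))"
      by (intro order_trans[OF meas_le[OF a]] mult_left_mono) auto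
    also have "\<dots> = ennreal (\<epsilon> * ((1 - norm a) powr (real k * q) * (1 - norm a) powr (2 / p * q)))"
      using C1 C2 by (simp add: \<epsilon>_def mult_ac flip: ennreal_mult)
    also have "(1 - norm a) powr (real k * q) * (1 - norm a) powr (2 / p * q) = (1 - norm a) powr e"
      by (simp add: e_def distrib_right powr_add)
    finally show ?thesis .
  qed
  \<comment> \<open>Finiteness comes from the test functions centred at 0, whose region is the whole
    disc.\<close>
  have "emeasure \<nu> disc < top"
    using loc[of 0] by (auto simp: near_0 intro: le_less_trans)
  moreover have "\<forall>w\<in>disc. emeasure \<nu> (ball w ((1 - norm w) / 2)) \<le> ennreal (\<epsilon> * (1 - norm w) powr e)"
  proof
    fix w assume "w \<in> disc"
    then have w: "norm w < 1" by (simp add: disc_def)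
    show "emeasure \<nu> (ball w ((1 - norm w) / 2)) \<le> ennreal (\<epsilon> * (1 - norm w) powr e)"
      using loc[OF w] emeasure_mono[OF ball_subset_near[OF w] sets_borel_measure_on_disc[OF nu sets_borel_near near_subset_disc]]
      by (rule order_trans[rotated])
  qed
  moreover obtain C where "C > 0" and "\<And>\<nu> \<epsilon> f. borel_measure_on_disc \<nu> \<Longrightarrow> emeasure \<nu> disc < top \<Longrightarrow> \<epsilon> \<ge> 0 \<Longrightarrow>
     \<forall>w\<in>disc. emeasure \<nu> (ball w ((1 - norm w) / 2)) \<le> ennreal (\<epsilon> * (1 - norm w) powr e) \<Longrightarrow>
     f \<in> bergman_space p \<Longrightarrow>
     (\<integral>\<^sup>+z. ennreal (norm (kderiv k f z) powr q) \<partial>\<nu>) \<le> ennreal (C * \<epsilon> * bergman_norm p f powr q)"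
    using carleson_bound_of_local[OF p pq, of k, folded e_def] by metis
  ultimately show ?thesis
    unfolding carleson_def \<nu>_def[symmetric] using \<epsilon> nu
    by (intro exI[of _ "C * \<epsilon>"] conjI mult_pos_pos) auto
qed

section \<open>Vanishing Sobolev Carleson measures\<close>

lemma tendsto_0_ennrealI:
  fixes f :: "'a \<Rightarrow> ennreal"
  assumes "\<And>\<eta>. \<eta> > 0 \<Longrightarrow> eventually (\<lambda>x. f x \<le> ennreal \<eta>) F"
  shows "(f \<longlongrightarrow> 0) F"
proof (rule order_tendstoI)
  fix a :: ennreal assume a: "0 < a"
  obtain \<eta> where \<eta>: "\<eta> > 0" "ennreal \<eta> < a"
  proof (cases a)
    case (real r)
    with a have "r > 0" by auto
    then show ?thesis
      using real by (intro that[of "r / 2"]) (auto intro!: ennreal_lessI)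
  qed (auto intro: that[of 1])
  show "eventually (\<lambda>x. f x < a) F"
    using assms[OF \<eta>(1)] by eventually_elim (use \<eta> in auto)
qed simp

lemma bergman_cmult:
  assumes f: "f \<in> bergman_space p" and p: "p > 0"
  shows "(\<lambda>z. c * f z) \<in> bergman_space p"
    and "bergman_norm p (\<lambda>z. c * f z) = norm c * bergman_norm p f"
proof -
  have hol: "f holomorphic_on disc"
    using f by (simp add: bergman_space_def)
  note [measurable] = borel_measurable_indicator_holomorphic[OF holomorphic_on_imp_continuous_on[OF hol] borel_open[OF open_disc], of p]
  have "(\<integral>\<^sup>+z. indicator disc z * ennreal (norm (c * f z) powr p) \<partial>lborel) =
     (\<integral>\<^sup>+z. ennreal (norm c powr p) * (indicator disc z * ennreal (norm (f z) powr p)) \<partial>lborel)"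
    by (intro nn_integral_cong) (simp add: norm_mult powr_mult ennreal_mult mult_ac)
  also have "\<dots> = ennreal (norm c powr p) * (\<integral>\<^sup>+z. indicator disc z * ennreal (norm (f z) powr p) \<partial>lborel)"
    by (intro nn_integral_cmult) simp
  finally have eq: "bergman_pnorm_pow p (\<lambda>z. c * f z) = ennreal (norm c powr p) * bergman_pnorm_pow p f"
    by (simp add: bergman_pnorm_pow_def ennreal_times_divide)
  show "(\<lambda>z. c * f z) \<in> bergman_space p"
    using f by (auto simp: bergman_space_def eq ennreal_mult_less_top intro!: holomorphic_intros)
  show "bergman_norm p (\<lambda>z. c * f z) = norm c * bergman_norm p f"
    using p by (simp add: bergman_norm_def eq enn2real_mult powr_mult powr_powr)
qed

lemma sobolev_op_cmult:
  assumes "f holomorphic_on disc" "z \<in> disc"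
  shows "sobolev_op n u (\<lambda>z. c * f z) z = c * sobolev_op n u f z"
  unfolding sobolev_op_def higher_deriv_cmult[OF assms open_disc]
  by (simp add: sum_distrib_left mult_ac)

lemma nn_integral_sobolev_op_cmult:
  assumes mu: "borel_measure_on_disc \<mu>" and u: "\<And>k. k \<le> n \<Longrightarrow> u k holomorphic_on disc"
    and f: "f holomorphic_on disc"
  shows "(\<integral>\<^sup>+z. ennreal (norm (sobolev_op n u (\<lambda>z. c * f z) z) powr q) \<partial>\<mu>) =
    ennreal (norm c powr q) * (\<integral>\<^sup>+z. ennreal (norm (sobolev_op n u f z) powr q) \<partial>\<mu>)"
proof -
  have [measurable]: "sobolev_op n u f \<in> borel_measurable \<mu>"
    by (intro measurable_holomorphic_disc[OF mu] holomorphic_sobolev_op u f)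
  have "(\<integral>\<^sup>+z. ennreal (norm (sobolev_op n u (\<lambda>z. c * f z) z) powr q) \<partial>\<mu>) =
      (\<integral>\<^sup>+z. ennreal (norm c powr q) * ennreal (norm (sobolev_op n u f z) powr q) \<partial>\<mu>)"
    by (intro nn_integral_cong)
       (simp add: sobolev_op_cmult[OF f] space_borel_measure_on_disc[OF mu] norm_mult powr_mult ennreal_mult)
  also have "\<dots> = ennreal (norm c powr q) * (\<integral>\<^sup>+z. ennreal (norm (sobolev_op n u f z) powr q) \<partial>\<mu>)"
    by (intro nn_integral_cmult) measurable
  finally show ?thesis .
qed

lemma compact_subset_disc:
  assumes "compact K" "K \<subseteq> disc"
  obtains R where "0 \<le> R" "R < 1" "K \<subseteq> cball 0 R"
proof (cases "K = {}")
  case False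
  obtain x where "x \<in> K" "\<And>y. y \<in> K \<Longrightarrow> norm y \<le> norm x"
    using continuous_attains_sup[OF assms(1) False, of norm] continuous_on_norm_id by blast
  then show ?thesis
    using assms(2) by (intro that[of "norm x"]) (auto simp: disc_def)
qed (auto intro: that[of 0])

text \<open>This lets the vanishing condition, which speaks only about sequences, be applied to a
  single function.\<close>

lemma bergman_null_seq_scaled:
  assumes f: "f \<in> bergman_space p" and p: "p > 0"
  shows "bergman_null_seq p (\<lambda>j z. complex_of_real (1 / real (Suc j)) * f z)"
  unfolding bergman_null_seq_def
proof (intro conjI allI impI)
  show "(\<lambda>z. complex_of_real (1 / real (Suc j)) * f z) \<in> bergman_space p" for j
    by (rule bergman_cmult(1)[OF f p])
  have "1 / real (Suc j) * bergman_norm p f \<le> 1 * bergman_norm p f" for j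
    by (intro mult_right_mono) (auto simp: bergman_norm_def)
  then show "\<exists>M. \<forall>j. bergman_norm p (\<lambda>z. complex_of_real (1 / real (Suc j)) * f z) \<le> M"
    unfolding bergman_cmult(2)[OF f p] norm_of_real by auto
  fix K :: "complex set" assume K: "compact K \<and> K \<subseteq> disc"
  have "continuous_on K f"
    using f K by (intro holomorphic_on_imp_continuous_on) (auto simp: bergman_space_def intro: holomorphic_on_subset)
  then have "bounded (f ` K)"
    using K compact_continuous_image compact_imp_bounded by blast
  moreover have "(\<lambda>j. complex_of_real (1 / real (Suc j))) \<longlonglongrightarrow> 0"
    using LIMSEQ_inverse_real_of_nat tendsto_of_real[where 'a = complex]
    by (fastforce simp: inverse_eq_divide)
  then have "uniform_limit K (\<lambda>j z. complex_of_real (1 / real (Suc j))) (\<lambda>_. 0) sequentially"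
    by (auto simp: uniform_limit_iff tendsto_iff elim: eventually_mono)
  ultimately have "uniform_limit K (\<lambda>j z. complex_of_real (1 / real (Suc j)) * f z) (\<lambda>z. 0 * f z) sequentially"
    by (intro uniform_lim_mult uniform_limit_const) (auto simp: image_constant_conv)
  then show "uniform_limit K (\<lambda>j z. complex_of_real (1 / real (Suc j)) * f z) (\<lambda>_. 0) sequentially"
    by simp
qed

text \<open>An infinite integral would stay infinite for all multiples of \<open>f\<close> by
  \<open>1 / (j + 1)\<close>, although these form a null sequence.\<close>

lemma vanishing_sobolev_carleson_finite:
  assumes mu: "borel_measure_on_disc \<mu>" and u: "\<And>k. k \<le> n \<Longrightarrow> u k holomorphic_on disc"
    and van: "vanishing_sobolev_carleson n u p q \<mu>" and f: "f \<in> bergman_space p" and p: "p > 0"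
  shows "(\<integral>\<^sup>+z. ennreal (norm (sobolev_op n u f z) powr q) \<partial>\<mu>) < top"
proof (rule ccontr)
  assume "\<not> (\<integral>\<^sup>+z. ennreal (norm (sobolev_op n u f z) powr q) \<partial>\<mu>) < top"
  then have top: "(\<integral>\<^sup>+z. ennreal (norm (sobolev_op n u f z) powr q) \<partial>\<mu>) = top"
    by (simp add: not_less top_unique)
  have hol: "f holomorphic_on disc"
    using f by (simp add: bergman_space_def)
  have "(\<lambda>j. \<integral>\<^sup>+z. ennreal (norm (sobolev_op n u (\<lambda>z. complex_of_real (1 / real (Suc j)) * f z) z) powr q) \<partial>\<mu>) \<longlonglongrightarrow> 0"
    using van bergman_null_seq_scaled[OF f p] unfolding vanishing_sobolev_carleson_def by blast
  moreover have "(\<integral>\<^sup>+z. ennreal (norm (sobolev_op n u (\<lambda>z. complex_of_real (1 / real (Suc j)) * f z) z) powr q) \<partial>\<mu>) = top" for j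
    by (subst nn_integral_sobolev_op_cmult[OF mu u hol]) (simp_all add: top ennreal_mult_top del: of_nat_Suc)
  ultimately have "(\<lambda>j::nat. top :: ennreal) \<longlonglongrightarrow> 0"
    by simp
  then show False
    by (simp add: LIMSEQ_const_iff)
qed

text \<open>The factor cancels the norm bound \<open>d powr (2 / p)\<close>. On a compact set the
  kernel denominator stays away from 0, so the high power of \<open>d\<close> in the test function
  outweighs the factor.\<close>

lemma bergman_null_seq_test_fun:
  assumes a: "\<And>j. norm (a j) < 1" and lim: "(\<lambda>j. norm (a j)) \<longlonglongrightarrow> 1"
    and i: "i \<le> n" and p: "p > 0" and m: "real m * p \<ge> 4"
  shows "bergman_null_seq p (\<lambda>j z. complex_of_real ((1 - norm (a j)) powr (- 2 / p)) * test_fun (n + m) (a j) i z)"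
  unfolding bergman_null_seq_def
proof (intro conjI allI impI)
  have mem: "test_fun (n + m) (a j) i \<in> bergman_space p" for j
    by (rule test_fun_bergman(2)[OF a i p m])
  show "(\<lambda>z. complex_of_real ((1 - norm (a j)) powr (- 2 / p)) * test_fun (n + m) (a j) i z) \<in> bergman_space p" for j
    by (rule bergman_cmult(1)[OF mem p])
  have "(1 - norm (a j)) powr (- 2 / p) * bergman_norm p (test_fun (n + m) (a j) i) \<le> 86 powr (1 / p)" for j
  proof -
    have "(1 - norm (a j)) powr (- 2 / p) * bergman_norm p (test_fun (n + m) (a j) i) \<le>
        (1 - norm (a j)) powr (- 2 / p) * (86 powr (1 / p) * (1 - norm (a j)) powr (2 / p))"
      by (intro mult_left_mono test_fun_bergman_norm[OF a i p m]) auto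
    also have "\<dots> = 86 powr (1 / p)"
      using a[of j] by (simp add: powr_minus field_simps)
    finally show ?thesis .
  qed
  then show "\<exists>M. \<forall>j. bergman_norm p (\<lambda>z. complex_of_real ((1 - norm (a j)) powr (- 2 / p)) * test_fun (n + m) (a j) i z) \<le> M"
    unfolding bergman_cmult(2)[OF mem p] norm_of_real by auto
  fix K :: "complex set" assume K: "compact K \<and> K \<subseteq> disc"
  then obtain R where R: "R < 1" "K \<subseteq> cball 0 R"
    using compact_subset_disc by metis
  have bd: "norm (complex_of_real ((1 - norm (a j)) powr (- 2 / p)) * test_fun (n + m) (a j) i z) \<le>
      (1 - norm (a j)) powr (2 / p) / (1 - R) ^ m" if z: "z \<in> K" for j z
  proof -
    define d where "d = 1 - norm (a j)"
    have d: "0 < d" "d \<le> 1" using a[of j] by (auto simp: d_def)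
    have zR: "norm z \<le> R" "norm z < 1" using z R by auto
    have "norm (cnj (a j) * z) \<le> 1 * norm z"
      unfolding norm_mult complex_mod_cnj using a[of j] by (intro mult_right_mono) auto
    then have ge: "1 - R \<le> norm (1 - cnj (a j) * z)"
      using norm_triangle_ineq2[of 1 "cnj (a j) * z"] zR by simp
    have "norm (test_fun (n + m) (a j) i z) \<le> (d / norm (1 - cnj (a j) * z)) ^ m"
      unfolding d_def by (rule norm_test_fun_le[OF a zR(2) i])
    also have "\<dots> \<le> (d / (1 - R)) ^ m"
      using ge R d by (intro power_mono divide_left_mono mult_pos_pos) auto
    also have "\<dots> = d powr real m / (1 - R) ^ m"
      using d by (simp add: power_divide powr_realpow)
    \<comment> \<open>As \<open>d \<le> 1\<close> and \<open>m \<ge> 4 / p\<close>, the power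
      \<open>4 / p\<close> is available, twice what the normalising factor uses up.\<close>
    also have "\<dots> \<le> d powr (4 / p) / (1 - R) ^ m"
      using d R m p by (intro divide_right_mono powr_mono') (auto simp: field_simps)
    finally have "d powr (- 2 / p) * norm (test_fun (n + m) (a j) i z) \<le> d powr (- 2 / p) * (d powr (4 / p) / (1 - R) ^ m)"
      by (intro mult_left_mono) auto
    also have "\<dots> = d powr (2 / p) / (1 - R) ^ m"
      by (simp add: diff_divide_distrib[symmetric] flip: powr_add add_divide_distrib)
    finally show ?thesis
      by (simp add: norm_mult d_def)
  qed
  have "(\<lambda>j. 1 - norm (a j)) \<longlonglongrightarrow> 0"
    using tendsto_diff[OF tendsto_const lim, of 1] by simp
  then have "(\<lambda>j. (1 - norm (a j)) powr (2 / p)) \<longlonglongrightarrow> 0"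
    using a p by (intro tendsto_zero_powrI[where b = "2 / p"]) (auto intro!: always_eventually less_imp_le)
  then have lim0: "(\<lambda>j. (1 - norm (a j)) powr (2 / p) / (1 - R) ^ m) \<longlonglongrightarrow> 0"
    by (rule tendsto_divide_zero)
  show "uniform_limit K (\<lambda>j z. complex_of_real ((1 - norm (a j)) powr (- 2 / p)) * test_fun (n + m) (a j) i z) (\<lambda>_. 0) sequentially"
  proof (rule uniform_limitI)
    fix \<eta> :: real assume "\<eta> > 0"
    with lim0 have "\<forall>\<^sub>F j in sequentially. (1 - norm (a j)) powr (2 / p) / (1 - R) ^ m < \<eta>"
      by (rule order_tendstoD)
    then show "\<forall>\<^sub>F j in sequentially. \<forall>z\<in>K. dist (complex_of_real ((1 - norm (a j)) powr (- 2 / p)) * test_fun (n + m) (a j) i z) 0 < \<eta>"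
    proof eventually_elim
      case (elim j)
      then show ?case
        using bd[of _ j] by (force simp: dist_norm)
    qed
  qed
qed

text \<open>If the bound failed arbitrarily close to the unit circle, the offending centres would
  give normalised test functions forming null sequences. Their integrals tend to 0, which
  contradicts the failure at a late index.\<close>

lemma vanishing_sobolev_carleson_decay:
  assumes p: "0 < p" and pq: "p \<le> q" and u: "\<And>k. k \<le> n \<Longrightarrow> u k holomorphic_on disc"
    and mu: "borel_measure_on_disc \<mu>" and van: "vanishing_sobolev_carleson n u p q \<mu>" and k: "k \<le> n"
    and \<epsilon>: "\<epsilon> > 0"
  obtains r where "0 \<le> r" "r < 1" "\<And>a. norm a < 1 \<Longrightarrow> norm a > r \<Longrightarrow>
    emeasure (weighted_measure \<mu> (u k) q) (near a) \<le> ennreal (\<epsilon> * (1 - norm a) powr ((real k + 2 / p) * q))"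
proof (rule ccontr)
  define e where "e = (real k + 2 / p) * q"
  define \<nu> where "\<nu> = weighted_measure \<mu> (u k) q"
  assume contr: "\<not> thesis"
  note obt = that
  have bad: "\<exists>a. norm a < 1 \<and> norm a > r \<and> emeasure \<nu> (near a) > ennreal (\<epsilon> * (1 - norm a) powr e)"
    if r: "0 \<le> r" "r < 1" for r
  proof (rule ccontr)
    assume "\<not> (\<exists>a. norm a < 1 \<and> norm a > r \<and> emeasure \<nu> (near a) > ennreal (\<epsilon> * (1 - norm a) powr e))"
    then have "emeasure \<nu> (near a) \<le> ennreal (\<epsilon> * (1 - norm a) powr e)" if "norm a < 1" "norm a > r" for a
      using that by (meson not_le)
    then have thesis
      unfolding \<nu>_def e_def by (rule obt[OF r])
    with contr show False by simp
  qed
  have "\<exists>a. norm a < 1 \<and> norm a > 1 - 1 / real (Suc j) \<and> emeasure \<nu> (near a) > ennreal (\<epsilon> * (1 - norm a) powr e)" for j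
    by (rule bad) auto
  then obtain a where a: "\<And>j. norm (a j) < 1" and a1: "\<And>j. norm (a j) > 1 - 1 / real (Suc j)"
    and big: "\<And>j. emeasure \<nu> (near (a j)) > ennreal (\<epsilon> * (1 - norm (a j)) powr e)"
    by metis
  have lim1: "(\<lambda>j. 1 - 1 / real (Suc j)) \<longlonglongrightarrow> 1"
    using tendsto_diff[OF tendsto_const LIMSEQ_inverse_real_of_nat, of 1] by (simp add: inverse_eq_divide)
  have lim: "(\<lambda>j. norm (a j)) \<longlonglongrightarrow> 1"
    by (rule tendsto_sandwich[OF _ _ lim1 tendsto_const]) (auto intro!: always_eventually less_imp_le a a1 simp del: of_nat_Suc)
  have q: "q > 0" using p pq by simp
  obtain m :: nat where "4 / p \<le> real m"
    using real_arch_simple by blast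
  then have m: "real m * p \<ge> 4"
    using p by (simp add: field_simps)
  define I where "I j i = (\<integral>\<^sup>+z. ennreal (norm (sobolev_op n u (test_fun (n + m) (a j) i) z) powr q) \<partial>\<mu>)" for j i
  obtain C where C: "C > 0" and meas_le: "\<And>a. norm a < 1 \<Longrightarrow>
     emeasure \<nu> (near a) \<le> ennreal (C * (1 - norm a) powr (real k * q)) *
       (\<Sum>i\<le>n. \<integral>\<^sup>+z. ennreal (norm (sobolev_op n u (test_fun (n + m) a i) z) powr q) \<partial>\<mu>)"
    using emeasure_weighted_measure_le[OF k q, of "n + m"] mu u unfolding \<nu>_def by blast
  have "(\<lambda>j. ennreal ((1 - norm (a j)) powr (- 2 / p * q)) * I j i) \<longlonglongrightarrow> 0" if i: "i \<le> n" for i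
  proof -
    have "(\<lambda>j. \<integral>\<^sup>+z. ennreal (norm (sobolev_op n u (\<lambda>z. complex_of_real ((1 - norm (a j)) powr (- 2 / p)) *
        test_fun (n + m) (a j) i z) z) powr q) \<partial>\<mu>) \<longlonglongrightarrow> 0"
      using van bergman_null_seq_test_fun[OF a lim i p m] unfolding vanishing_sobolev_carleson_def by blast
    then show ?thesis
      by (subst (asm) nn_integral_sobolev_op_cmult[OF mu u holomorphic_test_fun[OF a]])
         (simp_all add: powr_powr I_def)
  qed
  then have "(\<lambda>j. \<Sum>i\<le>n. ennreal ((1 - norm (a j)) powr (- 2 / p * q)) * I j i) \<longlonglongrightarrow> (\<Sum>i\<le>n. 0)"
    by (intro tendsto_sum) auto
  then have "(\<lambda>j. \<Sum>i\<le>n. ennreal ((1 - norm (a j)) powr (- 2 / p * q)) * I j i) \<longlonglongrightarrow> 0"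
    by simp
  then have "\<forall>\<^sub>F j in sequentially. (\<Sum>i\<le>n. ennreal ((1 - norm (a j)) powr (- 2 / p * q)) * I j i) < ennreal (\<epsilon> / C)"
    using \<epsilon> C by (intro order_tendstoD(2)) auto
  then obtain j where j: "(\<Sum>i\<le>n. ennreal ((1 - norm (a j)) powr (- 2 / p * q)) * I j i) < ennreal (\<epsilon> / C)"
    using eventually_happens by force
  define d where "d = 1 - norm (a j)"
  have d: "d > 0" using a by (simp add: d_def)
  have "emeasure \<nu> (near (a j)) \<le> ennreal (C * d powr (real k * q)) * (\<Sum>i\<le>n. I j i)"
    using meas_le[OF a] by (simp add: d_def I_def)
  \<comment> \<open>The split-off factor is the \<open>q\<close>-th power of the normalising factor
    and moves into the sum, which is already known to be small.\<close>
  also have "C * d powr (real k * q) = C * d powr e * d powr (- 2 / p * q)"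
    by (simp add: e_def algebra_simps flip: powr_add)
  also have "ennreal (C * d powr e * d powr (- 2 / p * q)) * (\<Sum>i\<le>n. I j i) =
      ennreal (C * d powr e) * (\<Sum>i\<le>n. ennreal (d powr (- 2 / p * q)) * I j i)"
    using C by (simp add: ennreal_mult mult.assoc flip: sum_distrib_left)
  also have "\<dots> \<le> ennreal (C * d powr e) * ennreal (\<epsilon> / C)"
    using j by (intro mult_left_mono) (auto simp: d_def)
  also have "\<dots> = ennreal (\<epsilon> * d powr e)"
    using C \<epsilon> by (simp add: mult_ac flip: ennreal_mult)
  finally show False
    using big[of j] by (simp add: d_def)
qed

section \<open>From decay of the local mass to vanishing Carleson measures\<close>

text \<open>Cauchy's inequality with radius \<open>h\<close> transfers convergence from the larger
  disc of radius \<open>R + h\<close>; \<open>t\<close> is chosen so that the resulting bound is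
  \<open>\<eta> / 2\<close>.\<close>

lemma uniform_limit_kderiv_null:
  assumes hol: "\<And>j. F j holomorphic_on disc"
    and lim: "\<And>K. compact K \<Longrightarrow> K \<subseteq> disc \<Longrightarrow> uniform_limit K F (\<lambda>_. 0) sequentially"
    and R: "R < 1"
  shows "uniform_limit (cball 0 R) (\<lambda>j. kderiv k (F j)) (\<lambda>_. 0) sequentially"
proof (rule uniform_limitI)
  fix \<eta> :: real assume \<eta>: "\<eta> > 0"
  define h where "h = (1 - R) / 2"
  have h: "h > 0" "R + h < 1"
    using R by (auto simp: h_def field_simps)
  define t where "t = \<eta> / 2 * h ^ k / fact k"
  have t: "t > 0"
    using \<eta> h by (simp add: t_def)
  have "uniform_limit (cball 0 (R + h)) F (\<lambda>_. 0) sequentially"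
    using h by (intro lim) (auto simp: disc_def)
  from uniform_limitD[OF this t]
  show "\<forall>\<^sub>F j in sequentially. \<forall>z\<in>cball 0 R. dist (kderiv k (F j) z) 0 < \<eta>"
  proof eventually_elim
    case (elim j)
    show ?case
    proof
      fix z :: complex assume z: "z \<in> cball 0 R"
      have sub: "cball z h \<subseteq> cball 0 (R + h)"
        using z by (intro cball_subset_cball_iff[THEN iffD2]) (auto simp: dist_norm norm_minus_commute)
      also have "\<dots> \<subseteq> disc"
        using h by (auto simp: disc_def)
      finally have sub': "cball z h \<subseteq> disc" .
      have hol': "F j holomorphic_on cball z h"
        by (rule holomorphic_on_subset[OF hol sub'])
      have "norm (kderiv k (F j) z) \<le> fact k * t / h ^ k"
      proof (rule Cauchy_inequality)
        show "F j holomorphic_on ball z h" "continuous_on (cball z h) (F j)"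
          by (rule holomorphic_on_subset[OF hol' ball_subset_cball], rule holomorphic_on_imp_continuous_on[OF hol'])
        fix x assume "norm (z - x) = h"
        then have "x \<in> cball 0 (R + h)"
          using sub by (auto simp: dist_norm)
        then show "norm (F j x) \<le> t"
          using elim by (auto simp: dist_norm less_imp_le)
      qed (use h in auto)
      also have "\<dots> = \<eta> / 2"
        using h by (simp add: t_def)
      also have "\<dots> < \<eta>"
        using \<eta> by simp
      finally show "dist (kderiv k (F j) z) 0 < \<eta>"
        by simp
    qed
  qed
qed

text \<open>The disc is cut at radius \<open>R\<close>. On the outer part the truncated measure
  satisfies the local bound with small \<open>\<epsilon>\<close> at every centre; on the inner part
  uniform convergence of the derivatives and finite mass suffice.\<close>

lemma vanishing_carleson_of_local:
  assumes p: "0 < p" and pq: "p \<le> q" and nu: "borel_measure_on_disc \<nu>" and fin: "emeasure \<nu> disc < top"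
    and decay: "\<And>\<epsilon>. \<epsilon> > 0 \<Longrightarrow> \<exists>r<1. 0 \<le> r \<and> (\<forall>w\<in>disc. norm w > r \<longrightarrow>
      emeasure \<nu> (ball w ((1 - norm w) / 2)) \<le> ennreal (\<epsilon> * (1 - norm w) powr ((real k + 2 / p) * q)))"
  shows "vanishing_carleson k p q \<nu>"
  unfolding vanishing_carleson_def
proof (intro allI impI tendsto_0_ennrealI)
  define e where "e = (real k + 2 / p) * q"
  have q: "q > 0" using p pq by simp
  fix F :: "nat \<Rightarrow> complex \<Rightarrow> complex" and \<eta> :: real
  assume null: "bergman_null_seq p F" and \<eta>: "\<eta> > 0"
  have mem: "F j \<in> bergman_space p" for j
    using null by (simp add: bergman_null_seq_def)
  then have hol: "F j holomorphic_on disc" for j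
    by (simp add: bergman_space_def)
  obtain M where M: "\<And>j. bergman_norm p (F j) \<le> M"
    using null by (auto simp: bergman_null_seq_def)
  have M0: "M \<ge> 0"
    using M[of 0] by (simp add: bergman_norm_def) (meson order_trans powr_ge_zero)
  obtain C where C: "C > 0" and bd: "\<And>\<nu> \<epsilon> f. borel_measure_on_disc \<nu> \<Longrightarrow> emeasure \<nu> disc < top \<Longrightarrow> \<epsilon> \<ge> 0 \<Longrightarrow>
     \<forall>w\<in>disc. emeasure \<nu> (ball w ((1 - norm w) / 2)) \<le> ennreal (\<epsilon> * (1 - norm w) powr e) \<Longrightarrow>
     f \<in> bergman_space p \<Longrightarrow>
     (\<integral>\<^sup>+z. ennreal (norm (kderiv k f z) powr q) \<partial>\<nu>) \<le> ennreal (C * \<epsilon> * bergman_norm p f powr q)"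
    using carleson_bound_of_local[OF p pq, of k, folded e_def] by metis
  \<comment> \<open>Chosen so that the outer part contributes at most \<open>\<eta> / 2\<close> for
    every \<open>j\<close>; \<open>M + 1\<close> is positive even when \<open>M = 0\<close>.\<close>
  define \<epsilon> where "\<epsilon> = \<eta> / (2 * C * (M + 1) powr q)"
  have \<epsilon>: "\<epsilon> > 0" using \<eta> C M0 by (simp add: \<epsilon>_def)
  obtain r where r: "0 \<le> r" "r < 1" and loc: "\<And>w. w \<in> disc \<Longrightarrow> norm w > r \<Longrightarrow>
      emeasure \<nu> (ball w ((1 - norm w) / 2)) \<le> ennreal (\<epsilon> * (1 - norm w) powr e)"
    using decay[OF \<epsilon>, folded e_def] by blast
  \<comment> \<open>The largest value of \<open>norm w + (1 - norm w) / 2\<close> for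
    \<open>norm w \<le> r\<close>: balls centred in the inner disc, where no decay is known, miss
    \<open>X\<close> altogether.\<close>
  define R where "R = (1 + r) / 2"
  have R: "R < 1" using r by (simp add: R_def)
  define X where "X = disc - cball 0 R"
  have X: "X \<in> sets \<nu>" and Y: "cball 0 R \<in> sets \<nu>"
    using open_disc R by (auto intro!: sets_borel_measure_on_disc[OF nu] simp: X_def disc_def)
  define \<nu>' where "\<nu>' = density \<nu> (indicator X)"
  have nu': "borel_measure_on_disc \<nu>'"
    unfolding \<nu>'_def by (rule borel_measure_on_disc_density[OF nu])
  have em: "emeasure \<nu>' A = emeasure \<nu> (X \<inter> A)" if "A \<in> sets \<nu>" for A
  proof -
    have "emeasure \<nu>' A = (\<integral>\<^sup>+z. indicator X z * indicator A z \<partial>\<nu>)"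
      unfolding \<nu>'_def using X that by (intro emeasure_density) auto
    also have "\<dots> = (\<integral>\<^sup>+z. indicator (X \<inter> A) z \<partial>\<nu>)"
      by (intro nn_integral_cong) (auto split: split_indicator)
    finally show ?thesis
      using X that by simp
  qed
  have disc_sets: "disc \<in> sets \<nu>"
    using open_disc by (intro sets_borel_measure_on_disc[OF nu]) auto
  have out: "(\<integral>\<^sup>+z. ennreal (norm (kderiv k (F j) z) powr q) \<partial>\<nu>') \<le> ennreal (\<eta> / 2)" for j
  proof -
    have "(\<integral>\<^sup>+z. ennreal (norm (kderiv k (F j) z) powr q) \<partial>\<nu>') \<le> ennreal (C * \<epsilon> * bergman_norm p (F j) powr q)"
    proof (rule bd[OF nu' _ less_imp_le[OF \<epsilon>] _ mem])
      show "emeasure \<nu>' disc < top"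
        using em[OF disc_sets] emeasure_mono[of "X \<inter> disc" disc \<nu>] disc_sets fin by (auto intro: le_less_trans)
      show "\<forall>w\<in>disc. emeasure \<nu>' (ball w ((1 - norm w) / 2)) \<le> ennreal (\<epsilon> * (1 - norm w) powr e)"
      proof
        fix w assume w: "w \<in> disc"
        then have w1: "norm w < 1" by (simp add: disc_def)
        have sets: "ball w ((1 - norm w) / 2) \<in> sets \<nu>"
          using ball_subset_near[OF w1] near_subset_disc by (intro sets_borel_measure_on_disc[OF nu]) auto
        show "emeasure \<nu>' (ball w ((1 - norm w) / 2)) \<le> ennreal (\<epsilon> * (1 - norm w) powr e)"
        proof (cases "norm w > r")
          case True
          have "emeasure \<nu>' (ball w ((1 - norm w) / 2)) \<le> emeasure \<nu> (ball w ((1 - norm w) / 2))"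
            unfolding em[OF sets] by (intro emeasure_mono sets) auto
          also have "\<dots> \<le> ennreal (\<epsilon> * (1 - norm w) powr e)"
            by (rule loc[OF w True])
          finally show ?thesis .
        next
          case False
          have "norm z \<le> R" if "z \<in> ball w ((1 - norm w) / 2)" for z
          proof -
            have "norm z < norm w + (1 - norm w) / 2"
              using that norm_triangle_sub[of z w] by (simp add: dist_norm norm_minus_commute field_simps)
            also have "\<dots> \<le> R"
              using False by (simp add: R_def field_simps)
            finally show ?thesis by simp
          qed
          then have "X \<inter> ball w ((1 - norm w) / 2) = {}"
            by (auto simp: X_def)
          then show ?thesis
            unfolding em[OF sets] by simp
        qed
      qed
    qed
    also have "C * \<epsilon> * bergman_norm p (F j) powr q \<le> C * \<epsilon> * (M + 1) powr q"
      using C \<epsilon> M[of j] q by (intro mult_left_mono powr_mono2) (auto simp: bergman_norm_def)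
    then have "ennreal (C * \<epsilon> * bergman_norm p (F j) powr q) \<le> ennreal (C * \<epsilon> * (M + 1) powr q)"
      by (rule ennreal_leI)
    also have "C * \<epsilon> * (M + 1) powr q = \<eta> / 2"
      using C M0 by (simp add: \<epsilon>_def)
    finally show ?thesis .
  qed
  obtain V where V: "emeasure \<nu> disc = ennreal V" "V \<ge> 0"
    using fin by (cases "emeasure \<nu> disc") auto
  \<comment> \<open>With this bound on the derivatives the inner part contributes at most
    \<open>\<eta> / 2\<close>; \<open>V + 1\<close> avoids a division by 0 for the null
    measure.\<close>
  define t where "t = (\<eta> / (2 * (V + 1))) powr (1 / q)"
  have t: "t > 0" using \<eta> V by (simp add: t_def)
  have "uniform_limit (cball 0 R) (\<lambda>j. kderiv k (F j)) (\<lambda>_. 0) sequentially"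
    using null by (intro uniform_limit_kderiv_null hol R) (auto simp: bergman_null_seq_def)
  from uniform_limitD[OF this t]
  show "\<forall>\<^sub>F j in sequentially. (\<integral>\<^sup>+z. ennreal (norm (kderiv k (F j) z) powr q) \<partial>\<nu>) \<le> ennreal \<eta>"
  proof eventually_elim
    case (elim j)
    have [measurable]: "kderiv k (F j) \<in> borel_measurable \<nu>"
      by (intro measurable_holomorphic_disc[OF nu] holomorphic_kderiv_disc hol)
    have meas: "(\<lambda>z. ennreal (norm (kderiv k (F j) z) powr q)) \<in> borel_measurable \<nu>"
      by measurable
    have "(\<integral>\<^sup>+z. ennreal (norm (kderiv k (F j) z) powr q) \<partial>\<nu>) =
        (\<integral>\<^sup>+z. indicator X z * ennreal (norm (kderiv k (F j) z) powr q) +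
           ennreal (norm (kderiv k (F j) z) powr q) * indicator (cball 0 R) z \<partial>\<nu>)"
      by (intro nn_integral_cong) (auto simp: X_def space_borel_measure_on_disc[OF nu] split: split_indicator)
    also have "\<dots> = (\<integral>\<^sup>+z. indicator X z * ennreal (norm (kderiv k (F j) z) powr q) \<partial>\<nu>) +
        (\<integral>\<^sup>+z. ennreal (norm (kderiv k (F j) z) powr q) * indicator (cball 0 R) z \<partial>\<nu>)"
      using X Y meas by (intro nn_integral_add borel_measurable_times_ennreal borel_measurable_indicator)
    also have "(\<integral>\<^sup>+z. indicator X z * ennreal (norm (kderiv k (F j) z) powr q) \<partial>\<nu>) =
        (\<integral>\<^sup>+z. ennreal (norm (kderiv k (F j) z) powr q) \<partial>\<nu>')"
      unfolding \<nu>'_def using X meas by (intro nn_integral_density[symmetric]) auto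
    also have "(\<integral>\<^sup>+z. ennreal (norm (kderiv k (F j) z) powr q) * indicator (cball 0 R) z \<partial>\<nu>) \<le>
        (\<integral>\<^sup>+z. ennreal (t powr q) * indicator (cball 0 R) z \<partial>\<nu>)"
      using elim q by (intro nn_integral_mono)
        (auto simp: dist_norm less_imp_le intro!: ennreal_leI powr_mono2 split: split_indicator)
    also have "\<dots> = ennreal (t powr q) * emeasure \<nu> (cball 0 R)"
      by (rule nn_integral_cmult_indicator[OF Y])
    also have "\<dots> \<le> ennreal (t powr q) * ennreal V"
      unfolding V(1)[symmetric] using R disc_sets by (intro mult_left_mono emeasure_mono) (auto simp: disc_def)
    also have "\<dots> = ennreal (\<eta> / (2 * (V + 1)) * V)"
      using q \<eta> V by (simp add: t_def powr_powr flip: ennreal_mult)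
    also have "\<dots> \<le> ennreal (\<eta> / 2)"
      using \<eta> V by (intro ennreal_leI) (simp add: field_simps)
    finally have "(\<integral>\<^sup>+z. ennreal (norm (kderiv k (F j) z) powr q) \<partial>\<nu>) \<le>
        (\<integral>\<^sup>+z. ennreal (norm (kderiv k (F j) z) powr q) \<partial>\<nu>') + ennreal (\<eta> / 2)"
      by (simp add: add_left_mono)
    also have "\<dots> \<le> ennreal (\<eta> / 2) + ennreal (\<eta> / 2)"
      by (intro add_right_mono out)
    also have "\<dots> = ennreal \<eta>"
      using \<eta> by (simp flip: ennreal_plus)
    finally show ?case .
  qed
qed

lemma vanishing_carleson_of_vanishing_sobolev_carleson:
  assumes p: "0 < p" and pq: "p \<le> q" and u: "\<And>k. k \<le> n \<Longrightarrow> u k holomorphic_on disc"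
    and mu: "borel_measure_on_disc \<mu>" and van: "vanishing_sobolev_carleson n u p q \<mu>" and k: "k \<le> n"
  shows "vanishing_carleson k p q (weighted_measure \<mu> (u k) q)"
proof (rule vanishing_carleson_of_local[OF p pq])
  have q: "q > 0" using p pq by simp
  show nu: "borel_measure_on_disc (weighted_measure \<mu> (u k) q)"
    by (rule borel_measure_on_disc_weighted_measure[OF mu])
  obtain m :: nat where "4 / p \<le> real m"
    using real_arch_simple by blast
  then have m: "real m * p \<ge> 4"
    using p by (simp add: field_simps)
  have "(\<integral>\<^sup>+z. ennreal (norm (sobolev_op n u (test_fun (n + m) 0 i) z) powr q) \<partial>\<mu>) < top" if "i \<le> n" for i
    using test_fun_bergman(2)[OF _ that p m, of 0]
    by (intro vanishing_sobolev_carleson_finite[OF mu u van _ p]) auto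
  then have "(\<Sum>i\<le>n. \<integral>\<^sup>+z. ennreal (norm (sobolev_op n u (test_fun (n + m) 0 i) z) powr q) \<partial>\<mu>) < top"
    by auto
  moreover obtain C where "\<And>a. norm a < 1 \<Longrightarrow> emeasure (weighted_measure \<mu> (u k) q) (near a) \<le>
       ennreal (C * (1 - norm a) powr (real k * q)) *
       (\<Sum>i\<le>n. \<integral>\<^sup>+z. ennreal (norm (sobolev_op n u (test_fun (n + m) a i) z) powr q) \<partial>\<mu>)"
    using emeasure_weighted_measure_le[OF k q, of "n + m"] mu u by blast
  \<comment> \<open>At \<open>a = 0\<close> the power of \<open>1 - norm a\<close> is 1, and
    finitely many finite integrals bound the total mass.\<close>
  from this[of 0] have "emeasure (weighted_measure \<mu> (u k) q) disc \<le>
       ennreal C * (\<Sum>i\<le>n. \<integral>\<^sup>+z. ennreal (norm (sobolev_op n u (test_fun (n + m) 0 i) z) powr q) \<partial>\<mu>)"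
    by (simp add: near_0)
  ultimately show "emeasure (weighted_measure \<mu> (u k) q) disc < top"
    by (simp add: ennreal_mult_less_top le_less_trans)
  fix \<epsilon> :: real assume "\<epsilon> > 0"
  then obtain r where r: "0 \<le> r" "r < 1" "\<And>a. norm a < 1 \<Longrightarrow> norm a > r \<Longrightarrow>
    emeasure (weighted_measure \<mu> (u k) q) (near a) \<le> ennreal (\<epsilon> * (1 - norm a) powr ((real k + 2 / p) * q))"
    using vanishing_sobolev_carleson_decay[OF p pq u mu van k] by metis
  show "\<exists>r<1. 0 \<le> r \<and> (\<forall>w\<in>disc. norm w > r \<longrightarrow> emeasure (weighted_measure \<mu> (u k) q) (ball w ((1 - norm w) / 2)) \<le>
      ennreal (\<epsilon> * (1 - norm w) powr ((real k + 2 / p) * q)))"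
  proof (intro exI[of _ r] conjI ballI impI r)
    fix w assume "w \<in> disc" and "norm w > r"
    then have w: "norm w < 1" by (simp add: disc_def)
    show "emeasure (weighted_measure \<mu> (u k) q) (ball w ((1 - norm w) / 2)) \<le>
      ennreal (\<epsilon> * (1 - norm w) powr ((real k + 2 / p) * q))"
      using r(3)[OF w \<open>norm w > r\<close>]
        emeasure_mono[OF ball_subset_near[OF w] sets_borel_measure_on_disc[OF nu sets_borel_near near_subset_disc]]
      by (rule order_trans[rotated])
  qed
qed

section \<open>Converse implications, by summing over the orders of differentiation\<close>

lemma sobolev_carleson_of_carleson:
  assumes q: "0 < q" and u: "\<And>k. k \<le> n \<Longrightarrow> u k holomorphic_on disc" and mu: "borel_measure_on_disc \<mu>"
    and car: "\<And>k. k \<le> n \<Longrightarrow> carleson k p q (weighted_measure \<mu> (u k) q)"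
  shows "sobolev_carleson n u p q \<mu>"
proof -
  have "\<forall>k\<in>{..n}. \<exists>C. C > 0 \<and> (\<forall>f\<in>bergman_space p.
     (\<integral>\<^sup>+z. ennreal (norm (kderiv k f z) powr q) \<partial>weighted_measure \<mu> (u k) q) \<le> ennreal (C * bergman_norm p f powr q))"
    using car by (auto simp: carleson_def)
  from bchoice[OF this] obtain C where C: "\<And>k. k \<le> n \<Longrightarrow> C k > 0"
    and bd: "\<And>k f. k \<le> n \<Longrightarrow> f \<in> bergman_space p \<Longrightarrow>
     (\<integral>\<^sup>+z. ennreal (norm (kderiv k f z) powr q) \<partial>weighted_measure \<mu> (u k) q) \<le> ennreal (C k * bergman_norm p f powr q)"
    by auto
  show ?thesis
    unfolding sobolev_carleson_def
  proof (intro exI[of _ "real (Suc n) powr q * (\<Sum>k\<le>n. C k)"] conjI ballI)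
    show "real (Suc n) powr q * (\<Sum>k\<le>n. C k) > 0"
      using C by (intro mult_pos_pos sum_pos) auto
    fix f assume f: "f \<in> bergman_space p"
    then have "(\<integral>\<^sup>+z. ennreal (norm (sobolev_op n u f z) powr q) \<partial>\<mu>) \<le> ennreal (real (Suc n) powr q) *
        (\<Sum>k\<le>n. \<integral>\<^sup>+z. ennreal (norm (kderiv k f z) powr q) \<partial>weighted_measure \<mu> (u k) q)"
      by (intro nn_integral_sobolev_op_le[OF mu u _ q]) (auto simp: bergman_space_def)
    also have "\<dots> \<le> ennreal (real (Suc n) powr q) * (\<Sum>k\<le>n. ennreal (C k * bergman_norm p f powr q))"
      using f by (intro mult_left_mono sum_mono bd) auto
    also have "(\<Sum>k\<le>n. ennreal (C k * bergman_norm p f powr q)) = ennreal (\<Sum>k\<le>n. C k * bergman_norm p f powr q)"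
      using C by (intro sum_ennreal) (auto simp: less_imp_le)
    also have "ennreal (real (Suc n) powr q) * \<dots> = ennreal (real (Suc n) powr q * (\<Sum>k\<le>n. C k) * bergman_norm p f powr q)"
      using C by (subst ennreal_mult[symmetric]) (auto simp: sum_distrib_right mult.assoc less_imp_le intro!: sum_nonneg)
    finally show "(\<integral>\<^sup>+z. ennreal (norm (sobolev_op n u f z) powr q) \<partial>\<mu>) \<le>
        ennreal (real (Suc n) powr q * (\<Sum>k\<le>n. C k) * bergman_norm p f powr q)" .
  qed
qed

lemma vanishing_sobolev_carleson_of_vanishing_carleson:
  assumes q: "0 < q" and u: "\<And>k. k \<le> n \<Longrightarrow> u k holomorphic_on disc" and mu: "borel_measure_on_disc \<mu>"
    and car: "\<And>k. k \<le> n \<Longrightarrow> vanishing_carleson k p q (weighted_measure \<mu> (u k) q)"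
  shows "vanishing_sobolev_carleson n u p q \<mu>"
  unfolding vanishing_sobolev_carleson_def
proof (intro allI impI)
  fix F assume null: "bergman_null_seq p F"
  then have hol: "F j holomorphic_on disc" for j
    by (simp add: bergman_null_seq_def bergman_space_def)
  have "(\<lambda>j. ennreal (real (Suc n) powr q) *
      (\<Sum>k\<le>n. \<integral>\<^sup>+z. ennreal (norm (kderiv k (F j) z) powr q) \<partial>weighted_measure \<mu> (u k) q)) \<longlonglongrightarrow>
      ennreal (real (Suc n) powr q) * (\<Sum>k\<le>n. 0)"
    using car null by (intro ennreal_tendsto_cmult tendsto_sum) (auto simp: vanishing_carleson_def)
  then have lim: "(\<lambda>j. ennreal (real (Suc n) powr q) *
      (\<Sum>k\<le>n. \<integral>\<^sup>+z. ennreal (norm (kderiv k (F j) z) powr q) \<partial>weighted_measure \<mu> (u k) q)) \<longlonglongrightarrow> 0"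
    by simp
  show "(\<lambda>j. \<integral>\<^sup>+z. ennreal (norm (sobolev_op n u (F j) z) powr q) \<partial>\<mu>) \<longlonglongrightarrow> 0"
    by (rule tendsto_sandwich[OF _ _ tendsto_const lim])
       (auto intro!: always_eventually nn_integral_sobolev_op_le[OF mu u hol q] simp del: of_nat_Suc)
qed

theorem theorem1p1:
  fixes n :: nat and p q :: real
    and u :: "nat \<Rightarrow> complex \<Rightarrow> complex" and \<mu> :: "complex measure"
  assumes "n \<ge> 1" and "0 < p" and "p \<le> q"
    and "\<And>k. k \<le> n \<Longrightarrow> u k holomorphic_on disc"
    and "borel_measure_on_disc \<mu>"
  shows "(sobolev_carleson n u p q \<mu> \<longleftrightarrow>
            (\<forall>k\<le>n. carleson k p q (weighted_measure \<mu> (u k) q)))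
       \<and> (vanishing_sobolev_carleson n u p q \<mu> \<longleftrightarrow>
            (\<forall>k\<le>n. vanishing_carleson k p q (weighted_measure \<mu> (u k) q)))"
proof -
  have q: "0 < q"
    using assms(2,3) by simp
  show ?thesis
  proof (intro conjI iffI allI impI)
    fix k assume "sobolev_carleson n u p q \<mu>" "k \<le> n"
    then show "carleson k p q (weighted_measure \<mu> (u k) q)"
      by (intro carleson_of_sobolev_carleson[where n = n and u = u] assms) auto
  next
    assume "\<forall>k\<le>n. carleson k p q (weighted_measure \<mu> (u k) q)"
    then show "sobolev_carleson n u p q \<mu>"
      by (intro sobolev_carleson_of_carleson[OF q assms(4,5)]) auto
  next
    fix k assume "vanishing_sobolev_carleson n u p q \<mu>" "k \<le> n"
    then show "vanishing_carleson k p q (weighted_measure \<mu> (u k) q)"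
      by (intro vanishing_carleson_of_vanishing_sobolev_carleson[where n = n and u = u] assms) auto
  next
    assume "\<forall>k\<le>n. vanishing_carleson k p q (weighted_measure \<mu> (u k) q)"
    then show "vanishing_sobolev_carleson n u p q \<mu>"
      by (intro vanishing_sobolev_carleson_of_vanishing_carleson[OF q assms(4,5)]) auto
  qed
qed

end
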